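(* Let $d\ge 1$, let $h\le -1$ be an integer, and let $\mathcal{V}_n$ be the particle cluster of the rotor-router model on $\mathbb{Z}^d$ with background height $h$ started with $n$ particles at the origin (with arbitrary initial direction function $D_0$). Then $$\lim_{n\to\infty}\lambda\left(\left(\tfrac{n}{|h|}\right)^{-1/d}\mathcal{V}_n\,\bigtriangleup\, B\right)=0,$$ where $\lambda$ is $d$-dimensional Lebesgue measure, $\bigtriangleup$ is symmetric difference, and $B$ is the Euclidean ball of unit volume centered at the origin in $\mathbb{R}^d$.
   Context: Rotor-router model with background height $h\le -1$ on $\mathbb{Z}^d$: fix an enumeration $\mathbf e_0,\dots,\mathbf e_{2d-1}$ of the $2d$ unit vectors $\pm$(coordinate vectors). A configuration consists of a particle function $H:\mathbb{Z}^d\to\mathbb{Z}$, a toppling function $T:\mathbb{Z}^d\to\mathbb{Z}$ and a direction function $D:\mathbb{Z}^d\to\{0,\dots,2d-1\}$. Initially $H_0(\mathbf 0)=n$, $H_0(\mathbf x)=h$ for $\mathbf x\neq\mathbf 0$, $T_0\equiv0$, and $D_0$ is arbitrary. A toppling of $\mathbf x$: $T(\mathbf x)$ increases by $1$, $H(\mathbf x)$ decreases by $1$, $D(\mathbf x)$ is replaced by $(D(\mathbf x)+1)\bmod 2d$, and $H(\mathbf x+\mathbf e_i)$ increases by $1$ where $i$ is the new value of $D(\mathbf x)$. A toppling is legal if $H(\mathbf x)\ge 0$ after it; a site is stable if $H(\mathbf x)\le 0$. Performing legal topplings until all sites are stable takes finitely many topplings, and the final configuration $(H_n,T_n,D_n)$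 does not depend on their order. For $\mathbf x\in\mathbb{Z}^d$ let $\mathbf x^\square=\mathbf x+[-\frac12,\frac12]^d$. The toppling cluster is $\mathcal{T}_n=\bigcup_{\mathbf x:T_n(\mathbf x)>0}\mathbf x^\square$ and the particle cluster is $\mathcal{V}_n=\mathcal{T}_n\cup\bigcup_{\mathbf x:H_n(\mathbf x)>h}\mathbf x^\square$. *)

theory Defs
  imports "HOL-Analysis.Analysis"
begin

text \<open>
  The lattice $Z^d$ is the type \<open>int ^ 'd\<close>, where \<open>'d\<close> is a finite index type with
  \<open>d = CARD('d)\<close>; Euclidean space is \<open>real ^ 'd\<close>.
\<close>

definition unit_vectors :: "(int ^ 'd) set" where
  "unit_vectors = {v. \<exists>i. v = axis i 1 \<or> v = - axis i 1}"

definition unit_vector_enumeration :: "(nat \<Rightarrow> int ^ 'd) \<Rightarrow> bool" where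
  "unit_vector_enumeration e \<longleftrightarrow> bij_betw e {..<2 * CARD('d)} unit_vectors"

record ('d :: finite) configuration =
  particles :: "int ^ 'd \<Rightarrow> int"
  topplings :: "int ^ 'd \<Rightarrow> int"
  direction :: "int ^ 'd \<Rightarrow> nat"

definition initial_configuration ::
  "int \<Rightarrow> (int ^ 'd \<Rightarrow> nat) \<Rightarrow> nat \<Rightarrow> 'd configuration" where
  "initial_configuration h D0 n =
     \<lparr>particles = (\<lambda>x. if x = 0 then int n else h),
      topplings = (\<lambda>x. 0),
      direction = D0\<rparr>"

text \<open>The rotor is advanced first; the particle then moves in the new direction.\<close>

definition topple ::
  "(nat \<Rightarrow> int ^ 'd) \<Rightarrow> int ^ 'd \<Rightarrow> 'd configuration \<Rightarrow> 'd configuration" where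
  "topple e x c =
     (let i = (direction c x + 1) mod (2 * CARD('d));
          H = (particles c)(x := particles c x - 1)
      in \<lparr>particles = H(x + e i := H (x + e i) + 1),
          topplings = (topplings c)(x := topplings c x + 1),
          direction = (direction c)(x := i)\<rparr>)"

definition legal_toppling ::
  "(nat \<Rightarrow> int ^ 'd) \<Rightarrow> 'd configuration \<Rightarrow> 'd configuration \<Rightarrow> bool" where
  "legal_toppling e c c' \<longleftrightarrow> (\<exists>x. c' = topple e x c \<and> particles c' x \<ge> 0)"

definition stable :: "('d :: finite) configuration \<Rightarrow> bool" where
  "stable c \<longleftrightarrow> (\<forall>x. particles c x \<le> 0)"

text \<open>
  For \<open>h \<le> -1\<close> the description below has exactly one solution: legal toppling
  terminates and its result does not depend on the order of the topplings.
\<close>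

definition final_configuration ::
  "(nat \<Rightarrow> int ^ 'd) \<Rightarrow> int \<Rightarrow> (int ^ 'd \<Rightarrow> nat) \<Rightarrow> nat \<Rightarrow> 'd configuration" where
  "final_configuration e h D0 n =
     (THE c. (legal_toppling e)\<^sup>*\<^sup>* (initial_configuration h D0 n) c \<and> stable c)"

definition cell :: "int ^ 'd \<Rightarrow> (real ^ 'd) set" where
  "cell x = (+) (\<chi> i. real_of_int (x $ i)) ` cbox (\<chi> i. - 1/2) (\<chi> i. 1/2)"

definition toppling_cluster ::
  "(nat \<Rightarrow> int ^ 'd) \<Rightarrow> int \<Rightarrow> (int ^ 'd \<Rightarrow> nat) \<Rightarrow> nat \<Rightarrow> (real ^ 'd) set" where
  "toppling_cluster e h D0 n =
     (\<Union>x \<in> {x. topplings (final_configuration e h D0 n) x > 0}. cell x)"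

definition particle_cluster ::
  "(nat \<Rightarrow> int ^ 'd) \<Rightarrow> int \<Rightarrow> (int ^ 'd \<Rightarrow> nat) \<Rightarrow> nat \<Rightarrow> (real ^ 'd) set" where
  "particle_cluster e h D0 n =
     toppling_cluster e h D0 n \<union>
     (\<Union>x \<in> {x. particles (final_configuration e h D0 n) x > h}. cell x)"

end

theory Submission
  imports Defs
begin

text \<open>
  Idea. If \<open>t\<close> is the odometer, the final height is the initial height plus \<open>\<Delta> t\<close>, up to the
  divergence of a bounded flow (each rotor serves its neighbours equally up to one particle).
  Least action bounds \<open>t\<close> by an explicit stable odometer, hence legal toppling terminates.

  Let \<open>A\<close> be the set of untoppled sites of the lattice ball \<open>B\<close> of volume \<open>n / \<bar>h\<bar>\<close> that keep
  away from the origin and from the boundary. Test the height equation against the potential \<open>\<psi>\<close>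
  with \<open>\<Delta> \<psi> = - 1\<^sub>A\<close> in \<open>B\<close> and \<open>\<psi> = 0\<close> outside. As \<open>t\<close> vanishes on \<open>A\<close> and the final height is
  at most \<open>0\<close>, this gives \<open>n \<psi>(0) \<le> \<bar>h\<bar> \<Sum> \<psi> + O(\<Sum> \<bar>\<nabla> \<psi>\<bar>)\<close>; by the energy identity the error
  is \<open>O(R\<^bsup>d+1\<^esup>)\<close>. On the other hand, summation by parts against a radial solution \<open>\<Gamma>\<close> of
  \<open>\<Delta> \<Gamma> = 1 - (constant mass near 0)\<close> that is larger on \<open>A\<close> than on the boundary of \<open>B\<close> by a
  multiple of \<open>R\<^sup>2\<close>, together with the gradient estimate for \<open>\<psi>\<close> near the origin, shows
  \<open>\<bar>h\<bar> \<Sum> \<psi> \<le> n \<psi>(0) - c \<bar>A\<bar> R\<^sup>2 + o(R\<^bsup>d+2\<^esup>)\<close>. Hence \<open>\<bar>A\<bar> = o(R\<^sup>d)\<close>: almost all of \<open>B\<close> topples,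
  and conservation of mass leaves only \<open>o(R\<^sup>d)\<close> sites of the cluster outside \<open>B\<close>.
\<close>

section \<open>The lattice Laplacian\<close>

definition lat :: "int ^ 'd \<Rightarrow> real ^ 'd" where
  "lat x = (\<chi> i. real_of_int (x $ i))"

text \<open>A sum over the 2d neighbours, not an average: |x|^2 has Laplacian 2d, and this constant
  recurs below.\<close>

definition laplacian :: "(int ^ 'd \<Rightarrow> real) \<Rightarrow> int ^ 'd \<Rightarrow> real" where
  "laplacian u x = (\<Sum>v\<in>unit_vectors. u (x + v) - u x)"

definition lattice_ball :: "real \<Rightarrow> (int ^ 'd) set" where
  "lattice_ball R = {x. norm (lat x) < R}"

lemma lat_nth [simp]: "lat x $ i = real_of_int (x $ i)"
  by (simp add: lat_def)

lemma lat_add: "lat (x + y) = lat x + lat y"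
  and lat_uminus: "lat (- x) = - lat x"
  and lat_0 [simp]: "lat 0 = 0"
  by (simp_all add: vec_eq_iff)

lemma lat_axis: "lat (axis i 1) = axis i 1"
  by (simp add: vec_eq_iff axis_def)

lemma norm_lat_sq: "(norm (lat (x :: int ^ 'd)))\<^sup>2 = (\<Sum>i\<in>UNIV. (real_of_int (x $ i))\<^sup>2)"
  by (simp add: norm_vec_def L2_set_def sum_nonneg)

lemma unit_vectors_eq:
  "(unit_vectors :: (int ^ 'd) set) = range (\<lambda>i. axis i 1) \<union> range (\<lambda>i. - axis i 1)"
  by (auto simp: unit_vectors_def)

lemma axis_neq_uminus_axis: "axis i (1::int) \<noteq> - axis j 1"
proof
  assume "axis i (1::int) = - axis j 1"
  then have "axis i (1::int) $ i = (- axis j 1) $ i" by simp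
  then show False by (simp add: axis_def split: if_splits)
qed

lemma sum_unit_vectors:
  "(\<Sum>v\<in>unit_vectors. f v) = (\<Sum>i\<in>UNIV. f (axis i 1) + f (- axis i (1 :: int) :: int ^ 'd))"
proof -
  have "(\<Sum>v\<in>unit_vectors. f v) =
      (\<Sum>v\<in>range (\<lambda>i. axis i 1). f v) + (\<Sum>v\<in>range (\<lambda>i. - axis i (1 :: int) :: int ^ 'd). f v)"
    unfolding unit_vectors_eq
    by (rule sum.union_disjoint) (use axis_neq_uminus_axis in auto)
  also have "\<dots> = (\<Sum>i\<in>UNIV. f (axis i 1)) + (\<Sum>i\<in>UNIV. f (- axis i 1))"
    by (subst (1 2) sum.reindex) (auto simp: inj_on_def axis_eq_axis)
  finally show ?thesis by (simp add: sum.distrib)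
qed

lemma finite_unit_vectors [simp]: "finite (unit_vectors :: (int ^ 'd) set)"
  by (simp add: unit_vectors_eq)

lemma card_unit_vectors: "card (unit_vectors :: (int ^ 'd) set) = 2 * CARD('d)"
  using sum_unit_vectors[of "\<lambda>_ :: int ^ 'd. 1 :: nat"] by simp

lemma uminus_unit_vectors: "v \<in> unit_vectors \<Longrightarrow> - v \<in> unit_vectors"
  by (auto simp: unit_vectors_def)

lemma bij_uminus_unit_vectors: "bij_betw uminus unit_vectors (unit_vectors :: (int ^ 'd) set)"
  by (rule bij_betw_byWitness[where f' = uminus]) (auto intro: uminus_unit_vectors)

lemma norm_lat_unit: "v \<in> unit_vectors \<Longrightarrow> norm (lat v) = 1"
  by (auto simp: unit_vectors_def lat_uminus lat_axis norm_axis_1)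

lemma norm_lat_step_le: "v \<in> unit_vectors \<Longrightarrow> norm (lat (x + v)) \<le> norm (lat x) + 1"
  using norm_triangle_ineq[of "lat x" "lat v"] by (simp add: lat_add norm_lat_unit)

lemma norm_lat_step_ge: "v \<in> unit_vectors \<Longrightarrow> norm (lat (x + v)) \<ge> norm (lat x) - 1"
  using norm_triangle_ineq2[of "lat x" "- lat v"] by (simp add: lat_add norm_lat_unit)

lemma norm_lat_sq_step:
  assumes "v \<in> unit_vectors"
  shows "(norm (lat (x + v)))\<^sup>2 - (norm (lat x))\<^sup>2 = 2 * (lat x \<bullet> lat v) + 1"
proof -
  have "(norm (lat (x + v)))\<^sup>2 = (norm (lat x))\<^sup>2 + 2 * (lat x \<bullet> lat v) + (norm (lat v))\<^sup>2"
    by (simp add: lat_add power2_norm_eq_inner algebra_simps inner_commute)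
  then show ?thesis using assms by (simp add: norm_lat_unit)
qed

lemma inner_lat_axis: "lat x \<bullet> lat (axis i 1) = real_of_int (x $ i)"
  by (simp add: lat_axis inner_axis)

text \<open>This and the next lemma give the first two moments, over the neighbours of x, of the
  increment of |x|^2; a Taylor expansion of a function of |x|^2 is built from them. Opposite
  neighbours cancel the odd terms.\<close>

lemma sum_step_1:
  "(\<Sum>v\<in>unit_vectors. 2 * (lat x \<bullet> lat v) + 1) = 2 * real CARD('d)"  for x :: "int ^ 'd"
  by (simp add: sum_unit_vectors lat_uminus)

lemma sum_step_2:
  "(\<Sum>v\<in>unit_vectors. (2 * (lat x \<bullet> lat v) + 1)\<^sup>2) = 8 * (norm (lat x))\<^sup>2 + 2 * real CARD('d)"
  for x :: "int ^ 'd"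
proof -
  have "(\<Sum>v\<in>unit_vectors. (2 * (lat x \<bullet> lat v) + 1)\<^sup>2)
      = (\<Sum>i\<in>UNIV. 8 * (real_of_int (x $ i))\<^sup>2 + 2)"
    by (simp add: sum_unit_vectors lat_uminus inner_lat_axis power2_eq_square algebra_simps)
  then show ?thesis by (simp add: sum.distrib norm_lat_sq sum_distrib_left)
qed

lemma laplacian_norm_sq: "laplacian (\<lambda>x. (norm (lat x))\<^sup>2) x = 2 * real CARD('d)" for x :: "int ^ 'd"
proof -
  have "laplacian (\<lambda>x. (norm (lat x))\<^sup>2) x = (\<Sum>v\<in>unit_vectors. 2 * (lat x \<bullet> lat v) + 1)"
    unfolding laplacian_def by (rule sum.cong) (simp_all add: norm_lat_sq_step)
  then show ?thesis by (simp only: sum_step_1)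
qed

lemma norm_lat_component: "\<bar>real_of_int (x $ i)\<bar> \<le> norm (lat x)"
  using component_le_norm_cart[of "lat x" i] by simp

lemma finite_box: "finite {x :: int ^ 'd. \<forall>i. \<bar>x $ i\<bar> \<le> N}"
proof (rule finite_imageD)
  show "inj_on vec_nth {x :: int ^ 'd. \<forall>i. \<bar>x $ i\<bar> \<le> N}"
    by (simp add: inj_on_def vec_nth_inject)
  have "vec_nth ` {x :: int ^ 'd. \<forall>i. \<bar>x $ i\<bar> \<le> N} \<subseteq> PiE UNIV (\<lambda>_. {- N..N})"
    by (auto simp: abs_le_iff minus_le_iff)
  then show "finite (vec_nth ` {x :: int ^ 'd. \<forall>i. \<bar>x $ i\<bar> \<le> N})"
    by (rule finite_subset) (simp add: finite_PiE)
qed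

lemma finite_lattice_ball [simp]: "finite (lattice_ball R :: (int ^ 'd) set)"
proof (rule finite_subset[OF _ finite_box[of "\<lceil>R\<rceil>"]])
  show "lattice_ball R \<subseteq> {x :: int ^ 'd. \<forall>i. \<bar>x $ i\<bar> \<le> \<lceil>R\<rceil>}"
  proof (clarsimp simp: lattice_ball_def)
    fix x :: "int ^ 'd" and i
    assume "norm (lat x) < R"
    then have "\<bar>real_of_int (x $ i)\<bar> < R" using norm_lat_component[of x i] by linarith
    then show "\<bar>x $ i\<bar> \<le> \<lceil>R\<rceil>" by linarith
  qed
qed

section \<open>Linearity of the Laplacian and summation by parts\<close>

lemma laplacian_diff: "laplacian (\<lambda>x. f x - g x) x = laplacian f x - laplacian g x"
  unfolding laplacian_def sum_subtractf[symmetric] by (intro sum.cong) simp_all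

lemma laplacian_add: "laplacian (\<lambda>x. f x + g x) x = laplacian f x + laplacian g x"
  unfolding laplacian_def sum.distrib[symmetric] by (intro sum.cong) simp_all

lemma laplacian_cmult: "laplacian (\<lambda>x. c * f x) x = c * laplacian f x"
  unfolding laplacian_def sum_distrib_left by (intro sum.cong) (simp_all add: algebra_simps)

lemma laplacian_const: "laplacian (\<lambda>x. c) x = 0"
  by (simp add: laplacian_def)

lemma laplacian_translate: "laplacian (\<lambda>x. f (z + x)) x = laplacian f (z + x)"
  by (simp add: laplacian_def add.assoc)

text \<open>\<open>A\<close> carries the support and \<open>S\<close> has to contain its translate,
  so shifts in all directions can be written as sums over one common set \<open>S\<close>.\<close>

lemma sum_shift:
  fixes f :: "int ^ 'd \<Rightarrow> 'b :: comm_monoid_add"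
  assumes "finite A" "finite S" "\<And>x. x \<notin> A \<Longrightarrow> f x = 0" "\<And>x. x \<in> A \<Longrightarrow> x - v \<in> S"
  shows "(\<Sum>x\<in>S. f (x + v)) = (\<Sum>x\<in>A. f x)"
proof -
  have "(\<Sum>x\<in>A. f x) = (\<Sum>x\<in>(\<lambda>x. x - v) ` A. f (x + v))"
    by (subst sum.reindex) (auto simp: inj_on_def)
  also have "\<dots> = (\<Sum>x\<in>S. f (x + v))"
  proof (rule sum.mono_neutral_left)
    show "\<forall>x\<in>S - (\<lambda>x. x - v) ` A. f (x + v) = 0"
    proof
      fix x assume "x \<in> S - (\<lambda>x. x - v) ` A"
      then have "x + v \<notin> A" by (auto intro: rev_image_eqI)
      then show "f (x + v) = 0" by (rule assms)
    qed
  qed (use assms in auto)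
  finally show ?thesis by simp
qed

text \<open>Shift the variable in each direction, then use that the unit vectors are closed under
  negation. \<open>S\<close> includes the neighbours of \<open>A\<close> because
  \<open>laplacian u\<close> can be nonzero one step outside the support of
  \<open>u\<close>.\<close>

lemma summation_by_parts:
  fixes u g :: "int ^ 'd \<Rightarrow> real"
  assumes fin: "finite A" "finite S" and u: "\<And>x. x \<notin> A \<Longrightarrow> u x = 0" and "A \<subseteq> S"
    and S: "\<And>x v. x \<in> A \<Longrightarrow> v \<in> unit_vectors \<Longrightarrow> x + v \<in> S"
  shows "(\<Sum>x\<in>A. u x * laplacian g x) = (\<Sum>x\<in>S. g x * laplacian u x)"
proof -
  have *: "(\<Sum>x\<in>S. g x * u (x + v)) = (\<Sum>x\<in>A. u x * g (x - v))" if v: "v \<in> unit_vectors" for v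
  proof -
    have "(\<Sum>x\<in>S. (\<lambda>y. g (y - v) * u y) (x + v)) = (\<Sum>x\<in>A. g (x - v) * u x)"
      using fin u S[OF _ uminus_unit_vectors[OF v]] by (intro sum_shift) auto
    then show ?thesis by (simp add: mult.commute)
  qed
  have **: "(\<Sum>x\<in>S. g x * u x) = (\<Sum>x\<in>A. u x * g x)"
    unfolding mult.commute[of "g _"]
    using fin u \<open>A \<subseteq> S\<close> by (intro sum.mono_neutral_right) auto
  have "(\<Sum>x\<in>S. g x * laplacian u x) = (\<Sum>v\<in>unit_vectors. \<Sum>x\<in>S. g x * u (x + v) - g x * u x)"
    unfolding laplacian_def sum_distrib_left right_diff_distrib by (rule sum.swap)
  also have "\<dots> = (\<Sum>v\<in>unit_vectors. \<Sum>x\<in>A. u x * (g (x - v) - g x))"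
    by (rule sum.cong[OF refl]) (simp only: sum_subtractf * ** right_diff_distrib)
  also have "\<dots> = (\<Sum>v\<in>unit_vectors. \<Sum>x\<in>A. u x * (g (x + v) - g x))"
    using sum.reindex_bij_betw[OF bij_uminus_unit_vectors, of "\<lambda>v. \<Sum>x\<in>A. u x * (g (x + v) - g x)"]
    by (simp only: diff_conv_add_uminus)
  also have "\<dots> = (\<Sum>x\<in>A. u x * laplacian g x)"
    unfolding laplacian_def sum_distrib_left by (rule sum.swap)
  finally show ?thesis by simp
qed

section \<open>Potentials and harmonic functions on the lattice\<close>

text \<open>The case of a constant test function. For a potential it says that the flux into the
  layer \<open>S - A\<close> equals the charge inside.\<close>

lemma sum_laplacian_eq_0:
  fixes u :: "int ^ 'd \<Rightarrow> real"
  assumes "finite A" "finite S" "\<And>x. x \<notin> A \<Longrightarrow> u x = 0" "A \<subseteq> S"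
    "\<And>x v. x \<in> A \<Longrightarrow> v \<in> unit_vectors \<Longrightarrow> x + v \<in> S"
  shows "(\<Sum>x\<in>S. laplacian u x) = 0"
  using summation_by_parts[OF assms, where g = "\<lambda>_. 1"] by (simp add: laplacian_const)

text \<open>The maximum principle in the form used below: at a maximum over a finite set, the
  neighbour provided here must lie outside that set.\<close>

lemma laplacian_strict_max:
  assumes "laplacian u x > 0"
  obtains v where "v \<in> unit_vectors" "u (x + v) > u x"
proof -
  have "\<exists>v\<in>unit_vectors. u (x + v) > u x"
  proof (rule ccontr)
    assume "\<not> ?thesis"
    then have "laplacian u x \<le> 0"
      unfolding laplacian_def by (intro sum_nonpos) (simp add: not_less)
    with assms show False by simp
  qed
  then show ?thesis using that by blast
qed

lemma lattice_ball_step: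
  "x \<in> lattice_ball R \<Longrightarrow> v \<in> unit_vectors \<Longrightarrow> x + v \<in> lattice_ball (R + 1)"
  using norm_lat_step_le[of v x] by (simp add: lattice_ball_def)

lemma lattice_ball_mono: "R \<le> R' \<Longrightarrow> lattice_ball R \<subseteq> lattice_ball R'"
  by (auto simp: lattice_ball_def)

text \<open>The fixed-point iteration for the Dirichlet problem, started at 0, increases and stays
  below a paraboloid with Laplacian -1; its limit solves the equation.\<close>

lemma green_potential_exists:
  fixes A :: "(int ^ 'd) set"
  assumes R: "R \<ge> 1"
  obtains \<psi> :: "int ^ 'd \<Rightarrow> real" where
    "\<And>x. x \<in> lattice_ball R \<Longrightarrow> laplacian \<psi> x = - indicator A x"
    "\<And>x. x \<notin> lattice_ball R \<Longrightarrow> \<psi> x = 0"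
    "\<And>x. 0 \<le> \<psi> x" "\<And>x. \<psi> x \<le> 2 * R\<^sup>2"
proof -
  define B :: "(int ^ 'd) set" where "B = lattice_ball R"
  define m where "m = 2 * real CARD('d)"
  have m: "m \<ge> 2" using zero_less_card_finite[where 'a='d] by (simp add: m_def)
  \<comment> \<open>Up to the factor 1 / m, \<open>g k x\<close> is the expected number of visits to
    \<open>A\<close> in k steps of simple random walk from x, killed on leaving
    \<open>B\<close>.\<close>
  define g where "g = rec_nat (\<lambda>x. 0 :: real) (\<lambda>_ f x.
      if x \<in> B then ((\<Sum>v\<in>unit_vectors. f (x + v)) + indicator A x) / m else 0)"
  have g0: "g 0 x = 0" for x by (simp add: g_def)
  have gS: "g (Suc k) x = (if x \<in> B then ((\<Sum>v\<in>unit_vectors. g k (x + v)) + indicator A x) / m else 0)"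
    for k x by (simp add: g_def)
  have g_nonneg: "g k x \<ge> 0" for k x
  proof (induction k arbitrary: x)
    case (Suc k) then show ?case using m by (auto simp: gS intro!: divide_nonneg_nonneg add_nonneg_nonneg sum_nonneg)
  qed (simp add: g0)
  have g_mono: "g k x \<le> g (Suc k) x" for k x
  proof (induction k arbitrary: x)
    case 0 show ?case by (simp add: g0 g_nonneg)
  next
    case (Suc k)
    have "(\<Sum>v\<in>unit_vectors. g k (x + v)) \<le> (\<Sum>v\<in>unit_vectors. g (Suc k) (x + v))"
      by (intro sum_mono Suc)
    then show ?case using m unfolding gS[of "Suc k"] gS[of k]
      by (auto intro!: divide_right_mono)
  qed
  \<comment> \<open>The radius R + 1 keeps the paraboloid nonnegative on those neighbours of
    \<open>B\<close> that lie outside \<open>B\<close>, where \<open>g\<close> vanishes.\<close>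
  define W :: "int ^ 'd \<Rightarrow> real" where "W x = ((R + 1)\<^sup>2 - (norm (lat x))\<^sup>2) / m" for x
  have W_nonneg: "W x \<ge> 0" if "x \<in> lattice_ball (R + 1)" for x
  proof -
    have "(norm (lat x))\<^sup>2 \<le> (R + 1)\<^sup>2"
      using that R by (intro power_mono) (auto simp: lattice_ball_def)
    then show ?thesis using m by (simp add: W_def)
  qed
  have LW: "(\<Sum>v\<in>unit_vectors. W (x + v)) = m * W x - 1" for x
  proof -
    have "laplacian W x = laplacian (\<lambda>x. (R + 1)\<^sup>2 / m - (1 / m) * (norm (lat x))\<^sup>2) x"
      by (rule arg_cong[of _ _ "\<lambda>f. laplacian f x"]) (auto simp: W_def diff_divide_distrib)
    also have "\<dots> = 0 - (1 / m) * m"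
      unfolding laplacian_diff laplacian_const laplacian_cmult laplacian_norm_sq m_def ..
    also have "\<dots> = - 1" using m by simp
    finally show ?thesis
      by (simp add: laplacian_def sum_subtractf card_unit_vectors m_def)
  qed
  have g_le: "g k x \<le> W x" if "x \<in> lattice_ball (R + 1)" for k x
    using that
  proof (induction k arbitrary: x)
    case 0 then show ?case by (simp add: g0 W_nonneg)
  next
    case (Suc k)
    show ?case
    proof (cases "x \<in> B")
      case True
      have "(\<Sum>v\<in>unit_vectors. g k (x + v)) \<le> (\<Sum>v\<in>unit_vectors. W (x + v))"
        using True by (intro sum_mono Suc lattice_ball_step) (auto simp: B_def)
      also have "\<dots> = m * W x - 1" by (rule LW)
      finally have "((\<Sum>v\<in>unit_vectors. g k (x + v)) + indicator A x) / m \<le> (m * W x) / m"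
        using m by (intro divide_right_mono) (auto simp: indicator_def)
      then show ?thesis using m True by (simp add: gS)
    qed (simp add: gS W_nonneg Suc.prems)
  qed
  have g_out: "g k x = 0" if "x \<notin> B" for k x
    using that by (cases k) (simp_all add: g0 gS)
  have g_bound: "g k x \<le> 2 * R\<^sup>2" for k x
  proof (cases "x \<in> B")
    case True
    have "g k x \<le> W x"
      using True lattice_ball_mono[of R "R + 1"] by (intro g_le) (auto simp: B_def)
    also have "\<dots> \<le> (2 * R)\<^sup>2 / m"
      unfolding W_def using m R power_mono[of "R + 1" "2 * R" 2] zero_le_power2[of "norm (lat x)"] by (intro divide_right_mono) linarith+
    also have "\<dots> \<le> (2 * R)\<^sup>2 / 2" using m by (intro divide_left_mono) auto
    finally show ?thesis by (simp add: power_mult_distrib)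
  qed (simp add: g_out)
  define \<psi> where "\<psi> x = lim (\<lambda>k. g k x)" for x
  have lim: "(\<lambda>k. g k x) \<longlonglongrightarrow> \<psi> x" for x
  proof -
    have "incseq (\<lambda>k. g k x)" by (intro incseq_SucI g_mono)
    moreover have "\<forall>k. g k x \<le> 2 * R\<^sup>2" by (simp add: g_bound)
    ultimately have "convergent (\<lambda>k. g k x)" using incseq_convergent unfolding convergent_def by metis
    then show ?thesis by (simp add: \<psi>_def convergent_LIMSEQ_iff)
  qed
  show ?thesis
  proof (rule that)
    fix x :: "int ^ 'd" assume "x \<in> lattice_ball R"
    then have x: "x \<in> B" by (simp add: B_def)
    have "(\<lambda>k. g (Suc k) x) \<longlonglongrightarrow> ((\<Sum>v\<in>unit_vectors. \<psi> (x + v)) + indicator A x) / m"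
      unfolding gS using x m by simp (intro tendsto_intros lim, simp)
    moreover have "(\<lambda>k. g (Suc k) x) \<longlonglongrightarrow> \<psi> x" using lim[of x] by (rule LIMSEQ_Suc)
    ultimately have "\<psi> x = ((\<Sum>v\<in>unit_vectors. \<psi> (x + v)) + indicator A x) / m"
      by (rule LIMSEQ_unique[symmetric])
    then show "laplacian \<psi> x = - indicator A x"
      using m by (simp add: laplacian_def sum_subtractf card_unit_vectors m_def field_simps)
  next
    fix x :: "int ^ 'd" assume "x \<notin> lattice_ball R"
    then show "\<psi> x = 0" using LIMSEQ_unique[OF lim[of x], of 0] by (simp add: g_out B_def)
  next
    fix x :: "int ^ 'd" show "0 \<le> \<psi> x" using lim[of x] by (rule LIMSEQ_le_const) (simp add: g_nonneg)
    show "\<psi> x \<le> 2 * R\<^sup>2" using lim[of x] by (rule LIMSEQ_le_const2) (simp add: g_bound)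
  qed
qed

text \<open>Pointwise, the squared gradient is the Laplacian of u^2 minus twice u times the
  Laplacian of u, and the former sums to zero. The factor 2 appears because every edge is counted in
  both orientations.\<close>

lemma sum_gradient_sq:
  fixes u :: "int ^ 'd \<Rightarrow> real"
  assumes "finite A" "finite S" "\<And>x. x \<notin> A \<Longrightarrow> u x = 0" "A \<subseteq> S"
    "\<And>x v. x \<in> A \<Longrightarrow> v \<in> unit_vectors \<Longrightarrow> x + v \<in> S"
  shows "(\<Sum>x\<in>S. \<Sum>v\<in>unit_vectors. (u (x + v) - u x)\<^sup>2) = - 2 * (\<Sum>x\<in>A. u x * laplacian u x)"
proof -
  have "(\<Sum>v\<in>unit_vectors. (u (x + v) - u x)\<^sup>2) = laplacian (\<lambda>x. (u x)\<^sup>2) x - 2 * (u x * laplacian u x)"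
    for x unfolding laplacian_def sum_distrib_left sum_subtractf[symmetric]
    by (intro sum.cong) (simp_all add: power2_eq_square algebra_simps)
  then have "(\<Sum>x\<in>S. \<Sum>v\<in>unit_vectors. (u (x + v) - u x)\<^sup>2)
      = (\<Sum>x\<in>S. laplacian (\<lambda>x. (u x)\<^sup>2) x) - 2 * (\<Sum>x\<in>S. u x * laplacian u x)"
    by (simp add: sum_subtractf sum_distrib_left)
  also have "(\<Sum>x\<in>S. laplacian (\<lambda>x. (u x)\<^sup>2) x) = 0"
    by (rule sum_laplacian_eq_0[OF assms(1,2)]) (use assms in auto)
  also have "(\<Sum>x\<in>S. u x * laplacian u x) = (\<Sum>x\<in>A. u x * laplacian u x)"
    by (rule sum.mono_neutral_right) (use assms in auto)
  finally show ?thesis by simp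
qed

text \<open>Reflecting \<open>x $ i\<close> to \<open>1 - x $ i\<close> swaps \<open>z\<close> and \<open>z + axis i 1\<close>. The difference \<open>u\<close> of
  \<open>\<psi>\<close> and its reflection is odd and is dominated by a strictly superharmonic barrier \<open>w\<close>
  that is of order \<open>M / \<rho>\<close> near the mirror.\<close>

lemma harmonic_gradient_axis_le:
  fixes \<psi> :: "int ^ 'd \<Rightarrow> real" and \<rho> M :: real
  assumes \<rho>: "\<rho> > 1" and M: "M > 0"
    and bound: "\<And>x. 0 \<le> \<psi> x" "\<And>x. \<psi> x \<le> M"
    and harm: "\<And>x. norm (lat x) < \<rho> \<Longrightarrow> laplacian \<psi> (z + x) = 0"
  shows "\<psi> (z + axis i 1) - \<psi> z \<le> M * (real CARD('d) + 2) / \<rho>"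
proof -
  define refl :: "int ^ 'd \<Rightarrow> int ^ 'd" where "refl x = (\<chi> j. if j = i then 1 - x $ i else x $ j)" for x
  define u where "u x = \<psi> (z + x) - \<psi> (z + refl x)" for x
  define d where "d = real CARD('d)"
  \<comment> \<open>|x|^2 reaches \<rho>^2 on the sphere. The coefficient d + 1 of the concave
    quadratic in \<open>x $ i\<close> turns the Laplacian 2d into -2, and the linear term, odd under
    the reflection, keeps the bracket nonnegative for 1 \<le> \<open>x $ i\<close> \<le> \<rho> +
    1.\<close>
  define q where "q x = (norm (lat x))\<^sup>2 + (d + 1) * (\<rho> * (2 * real_of_int (x $ i) - 1) -
      real_of_int (x $ i) * (real_of_int (x $ i) - 1))" for x :: "int ^ 'd"
  define w where "w x = (M / \<rho>\<^sup>2) * q x" for x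
  define D where "D = {x :: int ^ 'd. x $ i \<ge> 1 \<and> norm (lat x) < \<rho>}"
  have finD: "finite D"
    by (rule finite_subset[OF _ finite_lattice_ball[of \<rho>]]) (auto simp: D_def lattice_ball_def)
  have refl_refl: "refl (refl x) = x" for x by (simp add: refl_def vec_eq_iff)
  have u_le: "u x \<le> M" for x using bound[of "z + x"] bound[of "z + refl x"] by (simp add: u_def)
  have refl_add: "refl (x + v) = refl x + (\<chi> j. if j = i then - v $ i else v $ j)" for x v
    by (simp add: refl_def vec_eq_iff)
  have bij: "bij_betw (\<lambda>v. \<chi> j. if j = i then - v $ i else v $ j) unit_vectors (unit_vectors :: (int ^ 'd) set)"
  proof (rule bij_betw_byWitness[where f' = "\<lambda>v. \<chi> j. if j = i then - v $ i else v $ j"])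
    have "(\<chi> j. if j = i then - v $ i else v $ j) \<in> unit_vectors" if v: "v \<in> unit_vectors" for v :: "int ^ 'd"
    proof -
      obtain k where k: "v = axis k 1 \<or> v = - axis k 1" using v by (auto simp: unit_vectors_def)
      have "(\<chi> j. if j = i then - v $ i else v $ j) = (if k = i then - v else v)"
        using k by (auto simp: vec_eq_iff axis_def)
      then show ?thesis using v uminus_unit_vectors[OF v] by simp
    qed
    then show "(\<lambda>v. \<chi> j. if j = i then - v $ i else v $ j) ` unit_vectors \<subseteq> (unit_vectors :: (int ^ 'd) set)"
      "(\<lambda>v. \<chi> j. if j = i then - v $ i else v $ j) ` unit_vectors \<subseteq> (unit_vectors :: (int ^ 'd) set)"
      by blast+
  qed (auto simp: vec_eq_iff)
  have lap_refl: "laplacian (\<lambda>x. \<psi> (z + refl x)) x = laplacian (\<lambda>x. \<psi> (z + x)) (refl x)" for x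
    unfolding laplacian_def refl_add
    using sum.reindex_bij_betw[OF bij, of "\<lambda>v. \<psi> (z + (refl x + v)) - \<psi> (z + refl x)"] by simp
  have norm_refl: "norm (lat (refl x)) \<le> norm (lat x)" if "x $ i \<ge> 1" for x
  proof -
    have "\<bar>real_of_int (refl x $ j)\<bar> \<le> \<bar>real_of_int (x $ j)\<bar>" for j
      using that by (simp add: refl_def)
    then show ?thesis by (intro norm_le_componentwise_cart) simp
  qed
  have lap_u: "laplacian u x = 0" if "x \<in> D" for x
  proof -
    have "laplacian u x = laplacian (\<lambda>x. \<psi> (z + x)) x - laplacian (\<lambda>x. \<psi> (z + x)) (refl x)"
      unfolding u_def laplacian_diff lap_refl ..
    then show ?thesis using that norm_refl[of x] harm[of x] harm[of "refl x"]
      by (simp add: laplacian_translate D_def)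
  qed
  have lap_lin: "laplacian (\<lambda>x. real_of_int (x $ i)) x = 0" for x :: "int ^ 'd"
    by (simp add: laplacian_def sum_unit_vectors)
  have lap_sq: "laplacian (\<lambda>x. (real_of_int (x $ i))\<^sup>2) x = 2" for x :: "int ^ 'd"
  proof -
    have "laplacian (\<lambda>x. (real_of_int (x $ i))\<^sup>2) x = (\<Sum>j\<in>UNIV. if j = i then 2 else (0 :: real))"
      unfolding laplacian_def sum_unit_vectors
      by (intro sum.cong) (auto simp: axis_def power2_eq_square algebra_simps)
    then show ?thesis by simp
  qed
  have lap_q: "laplacian q x = - 2" for x
  proof -
    have "q = (\<lambda>x. (norm (lat x))\<^sup>2 + ((- (d + 1)) * (real_of_int (x $ i))\<^sup>2
        + ((d + 1) * (2 * \<rho> + 1) * real_of_int (x $ i) + (- (d + 1) * \<rho>))))"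
      by (rule ext) (simp add: q_def power2_eq_square algebra_simps)
    then have "laplacian q x = 2 * d + (- (d + 1)) * 2"
      by (simp only: laplacian_add laplacian_cmult laplacian_const lap_lin lap_sq laplacian_norm_sq d_def)
    then show ?thesis by simp
  qed
  have lap_w: "laplacian w x < 0" for x
    unfolding w_def laplacian_cmult lap_q using M \<rho> by simp
  \<comment> \<open>One step out of \<open>D\<close> overshoots the sphere by at most one, hence the
    bound \<open>\<rho> + 1\<close>.\<close>
  have w_far: "w x \<ge> M" if "x $ i \<ge> 1" "norm (lat x) \<ge> \<rho>" "real_of_int (x $ i) \<le> \<rho> + 1" for x
  proof -
    define t where "t = real_of_int (x $ i)"
    have t: "1 \<le> t" "t \<le> \<rho> + 1" using that by (simp_all add: t_def)
    have "t * (t - 1) \<le> t * \<rho>" using t by (intro mult_left_mono) auto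
    also have "\<dots> \<le> (2 * t - 1) * \<rho>" using t \<rho> by (intro mult_right_mono) auto
    finally have "0 \<le> (d + 1) * (\<rho> * (2 * t - 1) - t * (t - 1))"
      by (intro mult_nonneg_nonneg) (auto simp: d_def algebra_simps)
    moreover have "(norm (lat x))\<^sup>2 \<ge> \<rho>\<^sup>2" using that \<rho> by (intro power_mono) auto
    ultimately have "q x \<ge> \<rho>\<^sup>2" unfolding q_def t_def by linarith
    then have "(M / \<rho>\<^sup>2) * q x \<ge> (M / \<rho>\<^sup>2) * \<rho>\<^sup>2" using M by (intro mult_left_mono) auto
    then show ?thesis using \<rho> by (simp add: w_def)
  qed
  \<comment> \<open>For a neighbour across the mirror: as \<open>u\<close> is odd, this inequality
    makes \<open>u - w\<close> at the reflected site at most the negative of \<open>u - w\<close> at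
    x, so a positive maximum cannot be exceeded there.\<close>
  have w_mirror: "w x + w (refl x) \<ge> 0" if "x $ i = 1" for x
  proof -
    have "q x + q (refl x) = (norm (lat x))\<^sup>2 + (norm (lat (refl x)))\<^sup>2"
      using that by (simp add: q_def refl_def[of x] algebra_simps)
    then have "q x + q (refl x) \<ge> 0" by simp
    then show ?thesis using M unfolding w_def distrib_left[symmetric] by (intro mult_nonneg_nonneg) auto
  qed
  have main: "u x \<le> w x" if x: "x \<in> D" for x
  proof (rule ccontr)
    assume "\<not> u x \<le> w x"
    define s where "s = Max ((\<lambda>x. u x - w x) ` D)"
    have s_ge: "u y - w y \<le> s" if "y \<in> D" for y
      unfolding s_def using finD that by (intro Max_ge) auto
    have "s \<in> (\<lambda>x. u x - w x) ` D" unfolding s_def using finD x by (intro Max_in) auto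
    then obtain y where y: "y \<in> D" "s = u y - w y" by auto
    have s: "s > 0" using s_ge[OF x] \<open>\<not> u x \<le> w x\<close> by linarith
    have "laplacian (\<lambda>x. u x - w x) y > 0"
      unfolding laplacian_diff using lap_u[OF y(1)] lap_w[of y] by simp
    then obtain v where v: "v \<in> unit_vectors" "u (y + v) - w (y + v) > u y - w y"
      by (rule laplacian_strict_max)
    have notD: "y + v \<notin> D" using s_ge[of "y + v"] v(2) y(2) by auto
    have vi: "\<bar>v $ i\<bar> \<le> 1" and vj: "v $ i \<noteq> 0 \<Longrightarrow> j \<noteq> i \<Longrightarrow> v $ j = 0" for j
      using v(1) by (auto simp: unit_vectors_def axis_def)
    show False
    proof (cases "(y + v) $ i \<ge> 1")
      case True
      then have "norm (lat (y + v)) \<ge> \<rho>" using notD by (simp add: D_def)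
      moreover have "real_of_int ((y + v) $ i) \<le> \<rho> + 1"
        using norm_lat_component[of "y + v" i] norm_lat_step_le[OF v(1), of y] y(1)
        unfolding D_def mem_Collect_eq by linarith
      ultimately have "w (y + v) \<ge> M" using True by (intro w_far)
      then show False using u_le[of "y + v"] v(2) s y(2) by linarith
    next
      case False
      then have i: "y $ i = 1" "v $ i = - 1" using vi y(1) by (auto simp: D_def)
      then have "y + v = refl y" using vj by (auto simp: vec_eq_iff refl_def)
      then show False using w_mirror[OF i(1)] v(2) s y(2) by (simp add: u_def refl_refl)
    qed
  qed
  have refl_ax: "refl (axis i 1) = 0" by (simp add: refl_def vec_eq_iff axis_def)
  have "axis i 1 \<in> D" using \<rho> by (simp add: D_def lat_axis norm_axis_1)
  from main[OF this] have "\<psi> (z + axis i 1) - \<psi> z \<le> (M / \<rho>\<^sup>2) * (1 + (d + 1) * \<rho>)"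
    by (simp add: u_def refl_ax w_def q_def lat_axis norm_axis_1)
  also have "\<dots> \<le> (M / \<rho>\<^sup>2) * (\<rho> * (d + 2))"
    using M \<rho> by (intro mult_left_mono) (auto simp: algebra_simps)
  also have "\<dots> = M * (d + 2) / \<rho>" using \<rho> by (simp add: power2_eq_square field_simps)
  finally show ?thesis by (simp add: d_def algebra_simps)
qed

text \<open>For v = - axis i 1 the previous estimate is applied to \<open>M - \<psi>\<close> centred
  at \<open>z + v\<close>; moving the centre costs one unit of radius.\<close>

lemma harmonic_gradient_le:
  fixes \<psi> :: "int ^ 'd \<Rightarrow> real" and \<rho> M :: real
  assumes \<rho>: "\<rho> > 1" and M: "M > 0"
    and bound: "\<And>x. 0 \<le> \<psi> x" "\<And>x. \<psi> x \<le> M"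
    and harm: "\<And>x. norm (lat x) < \<rho> + 1 \<Longrightarrow> laplacian \<psi> (z + x) = 0"
    and v: "v \<in> unit_vectors"
  shows "\<psi> (z + v) - \<psi> z \<le> M * (real CARD('d) + 2) / \<rho>"
proof -
  obtain i where "v = axis i 1 \<or> v = - axis i 1" using v by (auto simp: unit_vectors_def)
  then show ?thesis
  proof
    assume "v = axis i 1"
    then show ?thesis using harmonic_gradient_axis_le[of \<rho> M \<psi> z i] \<rho> M bound harm by simp
  next
    assume v': "v = - axis i 1"
    have "laplacian (\<lambda>x. M - \<psi> x) (z + v + x) = 0" if "norm (lat x) < \<rho>" for x
    proof -
      have "norm (lat (x + v)) < \<rho> + 1" using norm_lat_step_le[OF v, of x] that by linarith
      from harm[OF this] show ?thesis
        by (simp add: laplacian_diff laplacian_const add.assoc add.commute[of v])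
    qed
    then have "(M - \<psi> (z + v + axis i 1)) - (M - \<psi> (z + v)) \<le> M * (real CARD('d) + 2) / \<rho>"
      using bound by (intro harmonic_gradient_axis_le \<rho> M) auto
    then show ?thesis by (simp add: v')
  qed
qed

text \<open>Follow a lattice path from the origin to x along which the l1 norm \<open>L\<close>
  grows by one at each step. It has at most d t steps, each costing one gradient estimate; the
  condition on \<rho>' keeps a ball of radius \<rho> + 1 around every site of the path inside the
  region of harmonicity.\<close>

lemma harmonic_near_origin_le:
  fixes \<psi> :: "int ^ 'd \<Rightarrow> real" and \<rho> \<rho>' t M :: real
  assumes \<rho>: "\<rho> > 1" and M: "M > 0"
    and bound: "\<And>x. 0 \<le> \<psi> x" "\<And>x. \<psi> x \<le> M"
    and harm: "\<And>x. norm (lat x) < \<rho>' \<Longrightarrow> laplacian \<psi> x = 0"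
    and \<rho>': "CARD('d) * t + \<rho> + 1 \<le> \<rho>'" and x: "norm (lat x) < t"
  shows "\<psi> x \<le> \<psi> 0 + CARD('d) * t * (M * (real CARD('d) + 2) / \<rho>)"
proof -
  define L where "L x = (\<Sum>i\<in>UNIV. nat \<bar>x $ i\<bar>)" for x :: "int ^ 'd"
  define c where "c = M * (real CARD('d) + 2) / \<rho>"
  have c: "c \<ge> 0" using M \<rho> by (simp add: c_def)
  have "norm (lat y) \<le> real k \<and> (real k \<le> CARD('d) * t \<longrightarrow> \<psi> y \<le> \<psi> 0 + real k * c)" if "L y = k" for y k
    using that
  proof (induction k arbitrary: y)
    case 0
    then have "y = 0" by (auto simp: L_def vec_eq_iff)
    then show ?case by simp
  next
    case (Suc k)
    obtain i where i: "y $ i \<noteq> 0" using Suc.prems by (fastforce simp: L_def intro: ccontr)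
    \<comment> \<open>A unit step along a nonzero coordinate of y, directed away from 0, so
      \<open>y - v\<close> is one step closer to the origin.\<close>
    define v :: "int ^ 'd" where "v = (if y $ i > 0 then axis i 1 else - axis i 1)"
    have v: "v \<in> unit_vectors" by (auto simp: v_def unit_vectors_def)
    have vj: "(y - v) $ j = (if j = i then y $ i - sgn (y $ i) else y $ j)" for j
      using i by (auto simp: v_def axis_def)
    have "L y = nat \<bar>y $ i\<bar> + (\<Sum>j\<in>UNIV - {i}. nat \<bar>y $ j\<bar>)"
      unfolding L_def by (rule sum.remove) auto
    moreover have "L (y - v) = nat \<bar>(y - v) $ i\<bar> + (\<Sum>j\<in>UNIV - {i}. nat \<bar>(y - v) $ j\<bar>)"
      unfolding L_def by (rule sum.remove) auto
    moreover have "(\<Sum>j\<in>UNIV - {i}. nat \<bar>(y - v) $ j\<bar>) = (\<Sum>j\<in>UNIV - {i}. nat \<bar>y $ j\<bar>)"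
      by (rule sum.cong) (auto simp: vj simp del: vector_minus_component)
    moreover have "nat \<bar>y $ i\<bar> = Suc (nat \<bar>(y - v) $ i\<bar>)"
      using i by (auto simp: vj sgn_if simp del: vector_minus_component)
    ultimately have Lk: "L (y - v) = k" using Suc.prems by simp
    note IH = Suc.IH[OF Lk]
    have n: "norm (lat y) \<le> real (Suc k)" using norm_lat_step_le[OF v, of "y - v"] IH by simp
    have "\<psi> y \<le> \<psi> 0 + real (Suc k) * c" if k: "real (Suc k) \<le> CARD('d) * t"
    proof -
      have "laplacian \<psi> ((y - v) + z) = 0" if "norm (lat z) < \<rho> + 1" for z
      proof (rule harm)
        have "norm (lat ((y - v) + z)) \<le> norm (lat (y - v)) + norm (lat z)"
          unfolding lat_add by (rule norm_triangle_ineq)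
        also have "\<dots> < \<rho>'" using IH that k \<rho>' by linarith
        finally show "norm (lat (y - v + z)) < \<rho>'" .
      qed
      then have "\<psi> ((y - v) + v) - \<psi> (y - v) \<le> c"
        unfolding c_def by (intro harmonic_gradient_le \<rho> M bound v)
      moreover have "\<psi> (y - v) \<le> \<psi> 0 + real k * c" using IH k by simp
      ultimately show ?thesis by (simp add: algebra_simps)
    qed
    with n show ?case by blast
  qed
  note * = this[OF refl, of x]
  have "real (L x) \<le> (\<Sum>i\<in>(UNIV :: 'd set). norm (lat x))"
    unfolding L_def of_nat_sum using norm_lat_component[of x] by (intro sum_mono) auto
  also have "\<dots> \<le> CARD('d) * t" using x by simp
  finally have L: "real (L x) \<le> CARD('d) * t" .
  then have "\<psi> x \<le> \<psi> 0 + real (L x) * c" using * by blast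
  also have "\<dots> \<le> \<psi> 0 + CARD('d) * t * c" using L c by (intro add_left_mono mult_right_mono)
  finally show ?thesis by (simp add: c_def)
qed

section \<open>The rotor-router odometer\<close>

text \<open>How many of the first t topplings of a site with initial direction a send a particle in
  direction i. The \<open>+ 1\<close> reflects that the rotor advances before the particle
  moves.\<close>

definition rotor_count :: "nat \<Rightarrow> nat \<Rightarrow> nat \<Rightarrow> nat \<Rightarrow> int" where
  "rotor_count m a t i = (\<Sum>k<t. of_bool ((a + k + 1) mod m = i))"

lemma rotor_count_0 [simp]: "rotor_count m a 0 i = 0"
  by (simp add: rotor_count_def)

lemma rotor_count_Suc: "rotor_count m a (Suc t) i = rotor_count m a t i + of_bool ((a + t + 1) mod m = i)"
  by (simp add: rotor_count_def)

lemma rotor_count_mono: "s \<le> t \<Longrightarrow> rotor_count m a s i \<le> rotor_count m a t i"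
  unfolding rotor_count_def by (intro sum_mono2) auto

lemma rotor_count_nonneg: "rotor_count m a t i \<ge> 0"
  unfolding rotor_count_def by (intro sum_nonneg) auto

lemma sum_rotor_count:
  assumes "m > 0"
  shows "(\<Sum>i<m. rotor_count m a t i) = int t"
proof (induction t)
  case (Suc t)
  have "(\<Sum>i<m. of_bool ((a + t + 1) mod m = i)) = (1 :: int)"
    using assms by (simp add: of_bool_def)
  with Suc show ?case by (simp add: rotor_count_Suc sum.distrib)
qed simp

text \<open>A full turn serves each direction once. This is explicit for a = 0; raising a by one
  drops the first term of the sum and appends an equal one at the end.\<close>

lemma rotor_count_period:
  assumes "i < m"
  shows "rotor_count m a m i = 1"
proof (induction a)
  case 0
  have "rotor_count m 0 m i = (\<Sum>k<m. of_bool (Suc k mod m = i))" by (simp add: rotor_count_def)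
  also have "\<dots> = (\<Sum>k<m. of_bool (k = (if i = 0 then m - 1 else i - 1)))"
    using assms by (intro sum.cong refl) (auto simp: mod_Suc)
  also have "\<dots> = 1" using assms by (auto simp: of_bool_def)
  finally show ?case .
next
  case (Suc a)
  define g :: "nat \<Rightarrow> int" where "g k = of_bool ((a + k + 1) mod m = i)" for k
  have "g m = g 0" by (simp add: g_def) (metis add.assoc add.commute mod_add_self1 plus_1_eq_Suc)
  have "rotor_count m (Suc a) m i = (\<Sum>k<m. g (Suc k))" by (simp add: rotor_count_def g_def)
  also have "\<dots> = (\<Sum>k<m. g k)"
    using \<open>g m = g 0\<close> sum.lessThan_Suc_shift[of g m] by simp
  also have "\<dots> = 1" using Suc by (simp add: rotor_count_def g_def)
  finally show ?case .
qed

lemma rotor_count_add: "rotor_count m a (s + t) i = rotor_count m a s i + rotor_count m (a + s) t i"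
  by (induction t) (simp_all add: rotor_count_Suc algebra_simps)

lemma rotor_count_mult:
  assumes "i < m"
  shows "rotor_count m a (m * q) i = int q"
  by (induction q arbitrary: a) (simp_all add: rotor_count_add rotor_count_period[OF assms])

text \<open>Full turns are exactly fair, and the incomplete last turn sends at most one particle in
  each direction.\<close>

lemma rotor_count_approx:
  assumes "i < m"
  shows "\<bar>real_of_int (rotor_count m a t i) - real t / real m\<bar> \<le> 1"
proof -
  define q s where "q = t div m" and "s = t mod m"
  have t: "t = m * q + s" by (simp add: q_def s_def)
  have s: "s < m" using assms by (simp add: s_def)
  have "rotor_count m a t i = int q + rotor_count m (a + m * q) s i"
    unfolding t rotor_count_add by (simp add: rotor_count_mult[OF assms])
  moreover have "rotor_count m (a + m * q) s i \<le> 1"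
    using rotor_count_mono[of s m m "a + m * q" i] s rotor_count_period[OF assms] by simp
  moreover have "rotor_count m (a + m * q) s i \<ge> 0" by (rule rotor_count_nonneg)
  moreover have "real t / real m = real q + real s / real m"
    using assms by (simp add: t field_simps)
  moreover have "0 \<le> real s / real m" "real s / real m \<le> 1" using s by (auto simp: divide_le_eq_1)
  ultimately show ?thesis by linarith
qed

section \<open>Configurations as functions of the odometer; termination\<close>

locale rotor_router =
  fixes e :: "nat \<Rightarrow> int ^ 'd" and h :: int and D0 :: "int ^ 'd \<Rightarrow> nat" and n m :: nat
  defines "m \<equiv> 2 * CARD('d)"
  assumes enum: "unit_vector_enumeration e"
    and h: "h \<le> -1"
    and D0: "\<forall>x. D0 x < 2 * CARD('d)"
begin

definition height0 :: "int ^ 'd \<Rightarrow> int" where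
  "height0 x = (if x = 0 then int n else h)"

definition inflow :: "(int ^ 'd \<Rightarrow> nat) \<Rightarrow> int ^ 'd \<Rightarrow> int" where
  "inflow t x = (\<Sum>i<m. rotor_count m (D0 (x - e i)) (t (x - e i)) i)"

definition height :: "(int ^ 'd \<Rightarrow> nat) \<Rightarrow> int ^ 'd \<Rightarrow> int" where
  "height t x = height0 x + inflow t x - int (t x)"

text \<open>The configuration after every site x has toppled \<open>t x\<close> times, in whatever
  order: recording only the odometer is where the abelian property enters.\<close>

definition state :: "(int ^ 'd \<Rightarrow> nat) \<Rightarrow> 'd configuration" where
  "state t = \<lparr>particles = height t, topplings = (\<lambda>x. int (t x)), direction = (\<lambda>x. (D0 x + t x) mod m)\<rparr>"

lemma m_pos [simp]: "m > 0" by (simp add: m_def)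

lemma e_unit: "i < m \<Longrightarrow> e i \<in> unit_vectors"
  using enum by (auto simp: unit_vector_enumeration_def m_def dest: bij_betwE)

lemma unit_neq_0: "v \<in> unit_vectors \<Longrightarrow> v \<noteq> 0"
  using norm_lat_unit by fastforce

lemma sum_e: "(\<Sum>i<m. f (e i)) = (\<Sum>v\<in>unit_vectors. f v)"
  using enum unfolding unit_vector_enumeration_def m_def by (rule sum.reindex_bij_betw)

lemma inflow_mono: "(\<And>x. s x \<le> t x) \<Longrightarrow> inflow s x \<le> inflow t x"
  unfolding inflow_def by (intro sum_mono rotor_count_mono)

lemma inflow_nonneg: "inflow t x \<ge> 0"
  unfolding inflow_def by (intro sum_nonneg rotor_count_nonneg)

lemma inflow_toppled:
  "inflow (t(x := Suc (t x))) y = inflow t y + of_bool (y = x + e ((D0 x + t x + 1) mod m))"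
proof -
  define i0 where "i0 = (D0 x + t x + 1) mod m"
  have "inflow (t(x := Suc (t x))) y
      = (\<Sum>i<m. rotor_count m (D0 (y - e i)) (t (y - e i)) i + (if i = i0 then of_bool (y = x + e i) else 0))"
    unfolding inflow_def
    by (intro sum.cong refl) (auto simp: rotor_count_Suc i0_def algebra_simps)
  also have "\<dots> = inflow t y + of_bool (y = x + e i0)"
    unfolding sum.distrib inflow_def by (simp add: i0_def)
  finally show ?thesis by (simp add: i0_def)
qed

lemma height_toppled:
  "height (t(x := Suc (t x))) y
    = height t y + of_bool (y = x + e ((D0 x + t x + 1) mod m)) - of_bool (y = x)"
  by (auto simp: height_def inflow_toppled)

lemma height_toppled_self: "height (t(x := Suc (t x))) x = height t x - 1"
  using unit_neq_0[OF e_unit, of "(D0 x + t x + 1) mod m"] by (simp add: height_toppled)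

lemma topple_state: "topple e x (state t) = state (t(x := Suc (t x)))"
proof -
  define i0 where "i0 = (D0 x + t x + 1) mod m"
  have i0: "((D0 x + t x) mod m + 1) mod m = i0" by (simp add: i0_def mod_simps)
  have i0': "Suc (D0 x + t x) mod m = i0" by (simp add: i0_def)
  have "e i0 \<noteq> 0" by (rule unit_neq_0[OF e_unit]) (simp add: i0_def)
  then have "((height t)(x := height t x - 1))(x + e i0 := ((height t)(x := height t x - 1)) (x + e i0) + 1)
      = height (t(x := Suc (t x)))"
    by (auto simp: fun_eq_iff height_toppled i0')
  moreover have "(\<lambda>y. (D0 y + t y) mod m)(x := i0) = (\<lambda>y. (D0 y + (t(x := Suc (t x))) y) mod m)"
    by (auto simp: fun_eq_iff i0_def)
  moreover have "(\<lambda>y. int (t y))(x := int (t x) + 1) = (\<lambda>y. int ((t(x := Suc (t x))) y))"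
    by auto
  ultimately show ?thesis
    unfolding topple_def state_def Let_def
    by (simp only: configuration.select_convs m_def[symmetric] i0)
qed

lemma initial_state: "initial_configuration h D0 n = state (\<lambda>_. 0)"
  using D0[folded m_def] by (simp add: initial_configuration_def state_def height_def[abs_def] height0_def inflow_def)

lemma particles_state [simp]: "particles (state t) = height t"
  and topplings_state [simp]: "topplings (state t) = (\<lambda>x. int (t x))"
  by (simp_all add: state_def)

text \<open>The last conjunct is the least action principle: the odometer of a legal toppling sequence
  lies below every odometer, legal or not, that leaves no positive site.\<close>

lemma reachable_state:
  assumes "(legal_toppling e)\<^sup>*\<^sup>* (initial_configuration h D0 n) c"
  obtains t where "c = state t" "\<And>x. t x > 0 \<Longrightarrow> height t x \<ge> 0"
    "\<And>s x. (\<And>y. height s y \<le> 0) \<Longrightarrow> t x \<le> s x"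
proof -
  have "\<exists>t. c = state t \<and> (\<forall>x. t x > 0 \<longrightarrow> height t x \<ge> 0) \<and> (\<forall>s. (\<forall>y. height s y \<le> 0) \<longrightarrow> (\<forall>x. t x \<le> s x))"
    using assms
  proof (induction rule: rtranclp_induct)
    case base
    show ?case by (rule exI[of _ "\<lambda>_. 0"]) (simp add: initial_state)
  next
    case (step c c')
    then obtain t where t: "c = state t" "\<And>x. t x > 0 \<Longrightarrow> height t x \<ge> 0"
      "\<And>s x. (\<forall>y. height s y \<le> 0) \<Longrightarrow> t x \<le> s x" by blast
    obtain x where x: "c' = topple e x c" "particles c' x \<ge> 0"
      using step.hyps(2) by (auto simp: legal_toppling_def)
    define t' where "t' = t(x := Suc (t x))"
    have c': "c' = state t'" by (simp add: x t(1) topple_state t'_def)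
    \<comment> \<open>Legality is tested after the toppling, so the height before it was at least
      1.\<close>
    have hx: "height t x \<ge> 1" using x(2) unfolding c' by (simp add: t'_def height_toppled_self)
    have "height t' y \<ge> 0" if "t' y > 0" for y
    proof (cases "y = x")
      case True then show ?thesis using x(2) by (simp add: c')
    next
      case False
      then show ?thesis using that t(2)[of y] by (simp add: t'_def height_toppled)
    qed
    moreover have "t' y \<le> s y" if s: "\<forall>y. height s y \<le> 0" for s y
    proof (rule ccontr)
      assume "\<not> t' y \<le> s y"
      \<comment> \<open>Only x was raised, so the comparison can fail only at x with
        \<open>t x = s x\<close>. There the inflow is monotone in the odometer, so
        \<open>height s x\<close> would be positive too.\<close>
      then have "y = x" "t x = s x" using t(3)[OF s, of x] t(3)[OF s, of y]
        by (auto simp: t'_def split: if_splits)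
      then have "height t x \<le> height s x"
        using inflow_mono[of t s x] t(3)[OF s] by (simp add: height_def)
      then show False using hx s by (metis not_one_le_zero order_trans)
    qed
    ultimately show ?case using c' by blast
  qed
  then show ?thesis using that by blast
qed

text \<open>An explicit odometer for the least action principle: triangular numbers, decreasing with
  the distance to the hyperplane \<open>x $ i = 0\<close> and zero from distance n on. The factor m
  makes every rotor complete whole turns, so each neighbour receives an exactly equal share.\<close>

definition barrier :: "'d \<Rightarrow> int ^ 'd \<Rightarrow> nat" where
  "barrier i x = m * ((Suc n - nat \<bar>x $ i\<bar>) choose 2)"

text \<open>The second difference of the triangular profile is at most 1 off the hyperplane, which
  \<open>h \<le> -1\<close> absorbs, and at most -n on it, which removes the n particles at the
  origin.\<close>

lemma barrier_stable: "height (barrier i) x \<le> 0"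
proof -
  define q where "q k = int ((Suc n - nat \<bar>k\<bar>) choose 2)" for k
  have "inflow (barrier i) x = (\<Sum>j<m. q ((x - e j) $ i))"
    unfolding inflow_def barrier_def by (intro sum.cong) (auto simp: rotor_count_mult q_def)
  also have "\<dots> = (\<Sum>v\<in>unit_vectors. q ((x - v) $ i))" by (rule sum_e)
  also have "\<dots> = (\<Sum>j\<in>UNIV. 2 * q (x $ i) + (if j = i then q (x $ i - 1) + q (x $ i + 1) - 2 * q (x $ i) else 0))"
    unfolding sum_unit_vectors by (intro sum.cong) (auto simp: axis_def)
  also have "\<dots> = int (barrier i x) + (q (x $ i - 1) + q (x $ i + 1) - 2 * q (x $ i))"
    by (simp add: sum.distrib barrier_def q_def m_def)
  finally have inflow: "inflow (barrier i) x - int (barrier i x) = q (x $ i - 1) + q (x $ i + 1) - 2 * q (x $ i)"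
    by simp
  define k where "k = x $ i"
  have tri: "int (Suc (Suc j) choose 2) = int (Suc j choose 2) + int j + 1"
     "int (Suc j choose 2) = int (j choose 2) + int j" for j
    by (simp_all add: numeral_2_eq_2)
  have "q (k - 1) + q (k + 1) - 2 * q k \<le> (if k = 0 then - int n else 1)"
  proof (cases "k = 0")
    case True
    then show ?thesis using tri(2)[of n] by (simp add: q_def)
  next
    case False
    define a where "a = nat \<bar>k\<bar> - 1"
    have nats: "nat \<bar>k\<bar> = Suc a" using False by (simp add: a_def)
    have "nat \<bar>k - 1\<bar> = a \<and> nat \<bar>k + 1\<bar> = Suc (Suc a) \<or> nat \<bar>k + 1\<bar> = a \<and> nat \<bar>k - 1\<bar> = Suc (Suc a)"
      using False by (cases "k > 0") (auto simp: a_def)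
    then have sum2: "q (k - 1) + q (k + 1) = int ((Suc n - a) choose 2) + int ((Suc n - Suc (Suc a)) choose 2)"
      unfolding q_def by (elim disjE conjE) (simp_all only: add.commute)
    show ?thesis
    proof (cases "Suc a \<le> n")
      case True
      then obtain j where "n = Suc a + j" by (auto simp: le_iff_add)
      then show ?thesis using False sum2 nats tri[of j] by (simp add: q_def Suc_diff_le)
    next
      case False
      then have "Suc n - a \<le> 1" by simp
      then have "(Suc n - a) choose 2 = 0" by (simp add: binomial_eq_0)
      then show ?thesis using sum2 nats False by (simp add: q_def binomial_eq_0)
    qed
  qed
  then show ?thesis
    using inflow h unfolding height_def height0_def k_def by (auto split: if_splits)
qed

text \<open>Barriers in all coordinates confine the reachable odometers to a box and bound them
  there, so one has maximal total; a positive site would allow a further legal toppling. Least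
  action, applied in both directions, makes the stable odometer unique. On toppled sites legality
  gives height at least 0 and stability at most 0.\<close>

lemma final_configuration_exists:
  obtains t where "final_configuration e h D0 n = state t"
    "\<And>x. height t x \<le> 0" "\<And>x. t x > 0 \<Longrightarrow> height t x = 0" "finite {x. t x > 0}"
proof -
  define reach where "reach t \<longleftrightarrow> (legal_toppling e)\<^sup>*\<^sup>* (initial_configuration h D0 n) (state t)" for t
  define box where "box = {x :: int ^ 'd. \<forall>i. \<bar>x $ i\<bar> \<le> int n}"
  define K where "K = m * (Suc n choose 2)"
  have finbox: "finite box" unfolding box_def by (rule finite_box)
  have state_inj: "state s = state t \<Longrightarrow> s = t" for s t
    by (auto simp: state_def fun_eq_iff)
  have reach_ge: "height t x \<ge> 0" if "reach t" "t x > 0" for t x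
    using reachable_state[OF that(1)[unfolded reach_def]] state_inj that(2) by metis
  have reach_le: "t x \<le> s x" if "reach t" "\<And>y. height s y \<le> 0" for t s x
    using reachable_state[OF that(1)[unfolded reach_def]] state_inj that(2) by metis
  have out: "x \<in> box" if "reach t" "t x > 0" for t x
  proof (rule ccontr)
    assume "x \<notin> box"
    then obtain i where "\<bar>x $ i\<bar> > int n" by (auto simp: box_def not_le)
    then have "barrier i x = 0" by (simp add: barrier_def)
    then show False using reach_le[OF that(1) barrier_stable, of x i] that(2) by simp
  qed
  have le_K: "t x \<le> K" if "reach t" for t x
  proof -
    \<comment> \<open>\<open>undefined\<close> stands for an arbitrary coordinate; the barrier of
      any one of them gives the uniform bound.\<close>
    have "t x \<le> barrier undefined x" by (rule reach_le[OF that barrier_stable])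
    also have "\<dots> \<le> K" unfolding barrier_def K_def by (intro mult_left_mono binomial_right_mono) auto
    finally show ?thesis .
  qed
  have "reach (\<lambda>_. 0)" by (simp add: reach_def initial_state)
  moreover have "\<forall>t. reach t \<longrightarrow> (\<Sum>x\<in>box. t x) < Suc (card box * K)"
    using sum_bounded_above[of box _ K] le_K by (simp add: less_Suc_eq_le)
  ultimately have "\<exists>t. reach t \<and> (\<forall>s. reach s \<longrightarrow> (\<Sum>x\<in>box. s x) \<le> (\<Sum>x\<in>box. t x))"
    by (rule Lattices_Big.ex_has_greatest_nat)
  then obtain t where t: "reach t" and max: "\<And>s. reach s \<Longrightarrow> (\<Sum>x\<in>box. s x) \<le> (\<Sum>x\<in>box. t x)"
    by blast
  have le_0: "height t x \<le> 0" for x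
  proof (rule ccontr)
    assume "\<not> height t x \<le> 0"
    define t' where "t' = t(x := Suc (t x))"
    have "legal_toppling e (state t) (state t')"
      unfolding legal_toppling_def using \<open>\<not> height t x \<le> 0\<close>
      by (intro exI[of _ x]) (simp add: topple_state t'_def height_toppled_self)
    then have t': "reach t'" using t unfolding reach_def by simp
    then have "x \<in> box" using out[of t' x] by (simp add: t'_def)
    then have "(\<Sum>x\<in>box. t x) < (\<Sum>x\<in>box. t' x)"
      using finbox by (intro sum_strict_mono_ex1) (auto simp: t'_def)
    then show False using max[OF t'] by simp
  qed
  have "final_configuration e h D0 n = state t"
    unfolding final_configuration_def
  proof (rule the_equality)
    show "(legal_toppling e)\<^sup>*\<^sup>* (initial_configuration h D0 n) (state t) \<and> stable (state t)"
      using t le_0 by (simp add: reach_def stable_def)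
  next
    fix c assume c: "(legal_toppling e)\<^sup>*\<^sup>* (initial_configuration h D0 n) c \<and> stable c"
    then obtain s where s: "c = state s" using reachable_state by blast
    have "s x = t x" for x
      using reach_le[of s t x] reach_le[of t s x] c t le_0
      by (auto simp: s reach_def stable_def)
    then have "s = t" by (simp add: fun_eq_iff)
    then show "c = state t" by (simp add: s)
  qed
  moreover have "finite {x. t x > 0}"
    using out[OF t] by (intro finite_subset[OF _ finbox]) auto
  moreover have "height t x = 0" if "t x > 0" for x
    using reach_ge[OF t that] le_0[of x] by simp
  ultimately show ?thesis using le_0 that by blast
qed

end

section \<open>Testing the height equation; conservation of mass\<close>

context rotor_router begin

text \<open>Each particle that moves from y to \<open>y + e i\<close> changes the \<psi>-weighted
  mass by the difference of \<psi>; the identity counts these moves.\<close>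

lemma sum_height_test:
  fixes \<psi> :: "int ^ 'd \<Rightarrow> real"
  assumes fin: "finite B" "finite S" and \<psi>: "\<And>x. x \<notin> B \<Longrightarrow> \<psi> x = 0" and "B \<subseteq> S"
    and S: "\<And>x v. x \<in> B \<Longrightarrow> v \<in> unit_vectors \<Longrightarrow> x + v \<in> S"
  shows "(\<Sum>x\<in>B. \<psi> x * real_of_int (height t x - height0 x))
    = (\<Sum>y\<in>S. \<Sum>i<m. real_of_int (rotor_count m (D0 y) (t y) i) * (\<psi> (y + e i) - \<psi> y))"
proof -
  define c where "c y i = real_of_int (rotor_count m (D0 y) (t y) i)" for y i
  have 1: "(\<Sum>x\<in>B. \<psi> x * c (x - e i) i) = (\<Sum>y\<in>S. c y i * \<psi> (y + e i))" if "i < m" for i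
  proof -
    have "(\<Sum>y\<in>S. (\<lambda>x. \<psi> x * c (x - e i) i) (y + e i)) = (\<Sum>x\<in>B. \<psi> x * c (x - e i) i)"
      using fin \<psi> S[OF _ uminus_unit_vectors[OF e_unit[OF that]]] by (intro sum_shift) auto
    then show ?thesis by (simp add: mult.commute)
  qed
  have 2: "(\<Sum>x\<in>B. \<psi> x * real (t x)) = (\<Sum>i<m. \<Sum>y\<in>S. c y i * \<psi> y)"
  proof -
    have t: "real (t y) = (\<Sum>i<m. c y i)" for y
      using sum_rotor_count[OF m_pos, of "D0 y" "t y"] unfolding c_def of_int_sum[symmetric] by simp
    have "(\<Sum>x\<in>B. \<psi> x * real (t x)) = (\<Sum>x\<in>S. \<psi> x * real (t x))"
      using fin \<psi> \<open>B \<subseteq> S\<close> by (intro sum.mono_neutral_left) auto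
    also have "\<dots> = (\<Sum>x\<in>S. \<Sum>i<m. c x i * \<psi> x)"
      unfolding t sum_distrib_left by (simp only: mult.commute)
    also have "\<dots> = (\<Sum>i<m. \<Sum>y\<in>S. c y i * \<psi> y)" by (rule sum.swap)
    finally show ?thesis .
  qed
  have "(\<Sum>x\<in>B. \<psi> x * real_of_int (height t x - height0 x))
      = (\<Sum>x\<in>B. \<Sum>i<m. \<psi> x * c (x - e i) i) - (\<Sum>x\<in>B. \<psi> x * real (t x))"
    unfolding sum_subtractf[symmetric]
    by (intro sum.cong) (simp_all add: height_def inflow_def c_def sum_distrib_left right_diff_distrib)
  also have "(\<Sum>x\<in>B. \<Sum>i<m. \<psi> x * c (x - e i) i) = (\<Sum>i<m. \<Sum>x\<in>B. \<psi> x * c (x - e i) i)"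
    by (rule sum.swap)
  also have "\<dots> = (\<Sum>i<m. \<Sum>y\<in>S. c y i * \<psi> (y + e i))"
    by (intro sum.cong refl 1) simp
  also have "\<dots> - (\<Sum>x\<in>B. \<psi> x * real (t x)) = (\<Sum>i<m. \<Sum>y\<in>S. c y i * (\<psi> (y + e i) - \<psi> y))"
    by (simp only: 2 right_diff_distrib sum_subtractf)
  also have "\<dots> = (\<Sum>y\<in>S. \<Sum>i<m. c y i * (\<psi> (y + e i) - \<psi> y))" by (rule sum.swap)
  finally show ?thesis by (simp only: c_def)
qed

text \<open>The rotors send \<open>t y / m\<close> particles from \<open>y\<close> to each neighbour up to an error of one. This
  error is the divergence of a bounded flow, so it only costs the gradient of \<open>\<psi>\<close>.\<close>

lemma test_inequality:
  fixes \<psi> :: "int ^ 'd \<Rightarrow> real"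
  assumes fin: "finite B" "finite S" and \<psi>: "\<And>x. x \<notin> B \<Longrightarrow> \<psi> x = 0" and "B \<subseteq> S"
    and S: "\<And>x v. x \<in> B \<Longrightarrow> v \<in> unit_vectors \<Longrightarrow> x + v \<in> S"
    and "0 \<in> B" and nonneg: "\<And>x. \<psi> x \<ge> 0" and stable: "\<And>x. height t x \<le> 0"
    and lap: "\<And>x. t x > 0 \<Longrightarrow> laplacian \<psi> x \<ge> 0"
  shows "(real n - real_of_int h) * \<psi> 0 \<le> - real_of_int h * (\<Sum>x\<in>B. \<psi> x)
    + (\<Sum>x\<in>S. \<Sum>v\<in>unit_vectors. \<bar>\<psi> (x + v) - \<psi> x\<bar>)"
proof -
  define c where "c y i = real_of_int (rotor_count m (D0 y) (t y) i)" for y i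
  have point: "(\<Sum>i<m. c y i * (\<psi> (y + e i) - \<psi> y)) \<ge> - (\<Sum>v\<in>unit_vectors. \<bar>\<psi> (y + v) - \<psi> y\<bar>)" for y
  proof -
    \<comment> \<open>The fair share of the flow reproduces the Laplacian, which has the right sign
      wherever the site has toppled.\<close>
    have "(\<Sum>i<m. real (t y) / real m * (\<psi> (y + e i) - \<psi> y)) = real (t y) / real m * laplacian \<psi> y"
      unfolding laplacian_def sum_e[symmetric] sum_distrib_left ..
    also have "\<dots> \<ge> 0" using lap[of y] by (cases "t y = 0") auto
    finally have "0 \<le> (\<Sum>i<m. real (t y) / real m * (\<psi> (y + e i) - \<psi> y))" .
    moreover have "(\<Sum>i<m. (real (t y) / real m - c y i) * (\<psi> (y + e i) - \<psi> y))
        \<le> (\<Sum>i<m. \<bar>\<psi> (y + e i) - \<psi> y\<bar>)"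
    proof (rule sum_mono)
      fix i assume "i \<in> {..<m}"
      then have "\<bar>real (t y) / real m - c y i\<bar> \<le> 1"
        using rotor_count_approx[of i m "D0 y" "t y"] by (simp add: c_def abs_minus_commute)
      then have "\<bar>(real (t y) / real m - c y i) * (\<psi> (y + e i) - \<psi> y)\<bar> \<le> 1 * \<bar>\<psi> (y + e i) - \<psi> y\<bar>"
        unfolding abs_mult by (intro mult_right_mono) auto
      from abs_le_D1[OF this]
      show "(real (t y) / real m - c y i) * (\<psi> (y + e i) - \<psi> y) \<le> \<bar>\<psi> (y + e i) - \<psi> y\<bar>"
        by (simp only: mult_1)
    qed
    moreover have "(\<Sum>i<m. \<bar>\<psi> (y + e i) - \<psi> y\<bar>) = (\<Sum>v\<in>unit_vectors. \<bar>\<psi> (y + v) - \<psi> y\<bar>)"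
      by (rule sum_e)
    ultimately show ?thesis by (simp add: left_diff_distrib sum_subtractf)
  qed
  have "- (\<Sum>x\<in>S. \<Sum>v\<in>unit_vectors. \<bar>\<psi> (x + v) - \<psi> x\<bar>)
      \<le> (\<Sum>y\<in>S. \<Sum>i<m. c y i * (\<psi> (y + e i) - \<psi> y))"
    by (subst sum_negf[symmetric], rule sum_mono, rule point)
  also have "\<dots> = (\<Sum>x\<in>B. \<psi> x * real_of_int (height t x - height0 x))"
    unfolding c_def by (rule sum_height_test[symmetric]) (use assms in auto)
  \<comment> \<open>Final heights are at most 0, and the initial height is h everywhere plus n - h
    at the origin.\<close>
  also have "\<dots> \<le> (\<Sum>x\<in>B. - real_of_int h * \<psi> x - (if x = 0 then (real n - real_of_int h) * \<psi> x else 0))"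
  proof (rule sum_mono)
    fix x
    have "\<psi> x * real_of_int (height t x - height0 x) \<le> \<psi> x * real_of_int (- height0 x)"
      using stable[of x] nonneg[of x] by (intro mult_left_mono) auto
    also have "\<dots> = - real_of_int h * \<psi> x - (if x = 0 then (real n - real_of_int h) * \<psi> x else 0)"
      by (simp add: height0_def algebra_simps)
    finally show "\<psi> x * real_of_int (height t x - height0 x) \<le> \<dots>" .
  qed
  also have "\<dots> = - real_of_int h * (\<Sum>x\<in>B. \<psi> x) - (real n - real_of_int h) * \<psi> 0"
    using \<open>0 \<in> B\<close> fin by (simp add: sum_subtractf sum_distrib_left)
  finally show ?thesis by linarith
qed

text \<open>The total excess of height over the background h is conserved and equals n - h. A
  toppled site ends at height 0 and holds excess -h, every other site of \<open>W\<close> holds at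
  least 1, and no site drops below h.\<close>

lemma mass_bound:
  fixes t :: "int ^ 'd \<Rightarrow> nat"
  defines "T \<equiv> {x. t x > 0}" and "W \<equiv> {x. t x > 0} \<union> {x. height t x > h}"
  assumes fin: "finite {x. t x > 0}" and h0: "\<And>x. t x > 0 \<Longrightarrow> height t x = 0"
  shows "finite W" "- h * int (card T) + int (card (W - T)) \<le> int n - h"
proof -
  have finT: "finite T" using fin by (simp add: T_def)
  \<comment> \<open>The origin, the toppled sites and their neighbours: everywhere else the height
    is still h.\<close>
  define S where "S = insert 0 (T \<union> (\<Union>v\<in>unit_vectors. (\<lambda>x. x + v) ` T))"
  have finS: "finite S" using finT by (simp add: S_def)
  have WS: "W \<subseteq> S"
  proof
    fix x assume x: "x \<in> W"
    show "x \<in> S"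
    proof (cases "x = 0 \<or> x \<in> T")
      case False
      then have "inflow t x > 0" using x by (auto simp: W_def T_def height_def height0_def)
      then have "(\<Sum>i<m. rotor_count m (D0 (x - e i)) (t (x - e i)) i) \<noteq> 0"
        by (simp add: inflow_def)
      then obtain i where i: "i < m" "rotor_count m (D0 (x - e i)) (t (x - e i)) i \<noteq> 0"
        by (rule sum.not_neutral_contains_not_neutral) auto
      then have "t (x - e i) > 0" by (cases "t (x - e i)") auto
      then have "x - e i \<in> T" by (simp add: T_def)
      then show ?thesis using e_unit[OF i(1)] unfolding S_def
        by (auto intro!: bexI[of _ "e i"] image_eqI[of _ _ "x - e i"])
    qed (auto simp: S_def)
  qed
  show "finite W" using WS finS by (rule finite_subset)
  have "(\<Sum>x\<in>S. rotor_count m (D0 (x - e i)) (t (x - e i)) i) = (\<Sum>x\<in>T. rotor_count m (D0 x) (t x) i)"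
    if "i < m" for i
  proof -
    have "(\<Sum>x\<in>S. (\<lambda>y. rotor_count m (D0 y) (t y) i) (x + (- e i))) = (\<Sum>x\<in>T. rotor_count m (D0 x) (t x) i)"
      using e_unit[OF that] by (intro sum_shift finS finT) (auto simp: T_def S_def)
    then show ?thesis by simp
  qed
  then have "(\<Sum>x\<in>S. inflow t x) = (\<Sum>i<m. \<Sum>x\<in>T. rotor_count m (D0 x) (t x) i)"
    unfolding inflow_def by (subst sum.swap) simp
  also have "\<dots> = (\<Sum>x\<in>T. int (t x))"
    by (subst sum.swap) (simp add: sum_rotor_count)
  also have "\<dots> = (\<Sum>x\<in>S. int (t x))"
    by (rule sum.mono_neutral_left) (use finS in \<open>auto simp: S_def T_def\<close>)
  finally have inflow: "(\<Sum>x\<in>S. inflow t x) = (\<Sum>x\<in>S. int (t x))" .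
  have "(\<Sum>x\<in>S. height t x - h) = (\<Sum>x\<in>S. height0 x - h)"
    using inflow by (simp add: height_def sum.distrib sum_subtractf)
  also have "\<dots> = (\<Sum>x\<in>S. if x = 0 then int n - h else 0)"
    by (intro sum.cong) (auto simp: height0_def)
  also have "\<dots> = int n - h" using finS by (simp add: S_def)
  finally have mass: "(\<Sum>x\<in>S. height t x - h) = int n - h" .
  have "- h * int (card T) + int (card (W - T)) = (\<Sum>x\<in>T. - h) + (\<Sum>x\<in>W - T. 1)" by simp
  also have "\<dots> \<le> (\<Sum>x\<in>T. height t x - h) + (\<Sum>x\<in>W - T. height t x - h)"
    by (intro add_mono sum_mono) (auto simp: T_def W_def h0)
  also have "\<dots> = (\<Sum>x\<in>W. height t x - h)"
    using \<open>finite W\<close> by (subst sum.subset_diff[of T W]) (auto simp: T_def W_def)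
  also have "\<dots> \<le> (\<Sum>x\<in>S. height t x - h)"
  proof (rule sum_mono2[OF finS WS])
    fix x assume "x \<in> S - W"
    then have "t x = 0" by (simp add: W_def)
    then have "height t x \<ge> height0 x" using inflow_nonneg[of t x] by (simp add: height_def)
    then show "0 \<le> height t x - h" using h by (auto simp: height0_def split: if_splits)
  qed
  finally show "- h * int (card T) + int (card (W - T)) \<le> int n - h" using mass by simp
qed

end

section \<open>A radial comparison function\<close>

text \<open>With s = |x|^2 / R^2 and p = d / 2, the function R^2 \<Phi>(s) has constant continuum
  Laplacian 2d off the origin, and its value and radial derivative vanish on the sphere of radius R.
  The power s^(1 - p) is the fundamental solution |x|^(2 - d) up to scaling; at p = 1 the logarithm
  replaces it.\<close>

lemma radial_profile_exists:
  obtains \<Phi> :: "real \<Rightarrow> real" where "\<Phi> 1 = 0"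
    "\<And>s. s > 0 \<Longrightarrow> (\<Phi> has_real_derivative 1 - s powr (- p)) (at s)"
proof (cases "p = 1")
  case True
  show ?thesis
  proof (rule that[of "\<lambda>s. s - 1 - ln s"])
    fix s :: real assume "s > 0"
    then show "((\<lambda>s. s - 1 - ln s) has_real_derivative 1 - s powr (- p)) (at s)"
      using True by (auto intro!: derivative_eq_intros simp: powr_minus field_simps)
  qed simp
next
  case False
  show ?thesis
  proof (rule that[of "\<lambda>s. s - 1 - (s powr (1 - p) - 1) / (1 - p)"])
    fix s :: real assume "s > 0"
    then have "((\<lambda>s. s powr (1 - p)) has_real_derivative (1 - p) * s powr (1 - p - 1)) (at s)"
      by (rule has_real_derivative_powr)
    from DERIV_diff[OF DERIV_diff[OF DERIV_ident DERIV_const[of 1]]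
        DERIV_cdivide[OF DERIV_diff[OF this DERIV_const[of 1]], of "1 - p"]]
    show "((\<lambda>s. s - 1 - (s powr (1 - p) - 1) / (1 - p)) has_real_derivative 1 - s powr (- p)) (at s)"
      using False by simp
  qed simp
qed

locale radial_profile =
  fixes \<Phi> :: "real \<Rightarrow> real" and p :: real
  assumes \<Phi>1: "\<Phi> 1 = 0" and p: "p > 0"
    and deriv: "\<And>s. s > 0 \<Longrightarrow> (\<Phi> has_real_derivative 1 - s powr (- p)) (at s)"
begin

text \<open>Convexity: the derivative \<open>1 - s powr (- p)\<close> increases because p >
  0.\<close>

lemma tangent_le:
  assumes "x > 0" "y > 0"
  shows "\<Phi> y - \<Phi> x \<ge> (1 - x powr (- p)) * (y - x)"
proof (cases x y rule: linorder_cases)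
  case less
  then obtain z where z: "x < z" "z < y" "\<Phi> y - \<Phi> x = (y - x) * (1 - z powr (- p))"
    using MVT2[of x y \<Phi> "\<lambda>s. 1 - s powr (- p)"] deriv assms by force
  have "z powr (- p) \<le> x powr (- p)" using z assms p by (intro powr_mono2') auto
  then have "(y - x) * (1 - x powr (- p)) \<le> (y - x) * (1 - z powr (- p))"
    using less by (intro mult_left_mono) auto
  then show ?thesis using z(3) by (simp add: mult.commute)
next
  case greater
  then obtain z where z: "y < z" "z < x" "\<Phi> x - \<Phi> y = (x - y) * (1 - z powr (- p))"
    using MVT2[of y x \<Phi> "\<lambda>s. 1 - s powr (- p)"] deriv assms by force
  have "x powr (- p) \<le> z powr (- p)" using z assms p by (intro powr_mono2') auto
  then have "(x - y) * (1 - z powr (- p)) \<le> (x - y) * (1 - x powr (- p))"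
    using greater by (intro mult_left_mono) auto
  then show ?thesis using z(3) by (simp add: algebra_simps)
qed simp

text \<open>The derivative changes sign at 1, so \<Phi> has its minimum 0 there. The gap between
  interior points and the boundary s = 1 is what penalises untoppled sites later.\<close>

lemma pos:
  assumes "0 < s" "s < 1"
  shows "\<Phi> s > 0"
proof -
  obtain z where z: "s < z" "z < 1" "\<Phi> 1 - \<Phi> s = (1 - s) * (1 - z powr (- p))"
    using MVT2[of s 1 \<Phi> "\<lambda>s. 1 - s powr (- p)"] deriv assms by force
  have "1 < z powr (- p)"
    using z assms p by (metis powr_less_mono2_neg powr_one_eq_one neg_less_0_iff_less less_trans)
  then have "(1 - s) * (1 - z powr (- p)) < 0" using assms by (intro mult_pos_neg) auto
  then show ?thesis using z(3) \<Phi>1 by simp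
qed

lemma antimono:
  assumes "0 < s" "s \<le> t" "t \<le> 1"
  shows "\<Phi> t \<le> \<Phi> s"
proof -
  have "1 \<le> t powr (- p)"
    using assms p powr_mono2'[of "- p" t 1] by simp
  then have "(1 - t powr (- p)) * (s - t) \<ge> 0" using assms by (intro mult_nonpos_nonpos) auto
  then show ?thesis using tangent_le[of t s] assms by simp
qed

lemma nonneg_mono:
  assumes "1 \<le> s" "s \<le> t"
  shows "0 \<le> \<Phi> s" "\<Phi> s \<le> \<Phi> t"
proof -
  have le: "u powr (- p) \<le> 1" if "1 \<le> u" for u
    using that p powr_mono2'[of "- p" 1 u] by simp
  have "0 \<le> (1 - 1 powr (- p)) * (s - 1)" by simp
  then show "0 \<le> \<Phi> s" using tangent_le[of 1 s] assms \<Phi>1 by simp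
  have "0 \<le> (1 - s powr (- p)) * (t - s)" using le assms by (intro mult_nonneg_nonneg) auto
  then show "\<Phi> s \<le> \<Phi> t" using tangent_le[of s t] assms by simp
qed

text \<open>Taylor expansion to third order; the third derivative decreases in absolute value, so
  its value at a controls the remainder.\<close>

lemma second_order_le:
  assumes a: "a > 0" and s: "s \<ge> a" "t \<ge> a"
  shows "\<Phi> t - \<Phi> s \<ge> (1 - s powr (- p)) * (t - s) + p * s powr (- p - 1) / 2 * (t - s)\<^sup>2
      - p * (p + 1) * a powr (- p - 2) / 6 * \<bar>t - s\<bar> ^ 3"
proof (cases "s = t")
  case False
  define diff where "diff k = (if k = 0 then \<Phi> else if k = 1 then (\<lambda>s. 1 - s powr (- p))
      else if k = 2 then (\<lambda>s. p * s powr (- p - 1)) else (\<lambda>s. - p * (p + 1) * s powr (- p - 2)))"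
    for k :: nat
  have "DERIV (diff k) z :> diff (Suc k) z" if "k < 3" "z > 0" for k z
  proof -
    consider "k = 0" | "k = 1" | "k = 2" using \<open>k < 3\<close> by linarith
    then show ?thesis
    proof cases
      case 1 then show ?thesis using deriv[OF \<open>z > 0\<close>] by (simp add: diff_def)
    next
      case 2 then show ?thesis using \<open>z > 0\<close>
        by (auto simp: diff_def intro!: derivative_eq_intros)
    next
      case 3 then show ?thesis using \<open>z > 0\<close>
        by (auto simp: diff_def intro!: derivative_eq_intros) (simp add: algebra_simps minus_diff_commute)
    qed
  qed
  moreover have "z > 0" if "min s t \<le> z" for z using that a s by auto
  ultimately obtain z where z: "if t < s then t < z \<and> z < s else s < z \<and> z < t"
    "\<Phi> t = (\<Sum>k<3. diff k s / fact k * (t - s) ^ k) + diff 3 z / fact 3 * (t - s) ^ 3"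
    using Taylor[of 3 diff \<Phi> "min s t" "max s t" s t] False by (force simp: diff_def[of 0])
  have "z \<ge> a" using z(1) s by (auto split: if_splits)
  have "\<bar>diff 3 z / fact 3 * (t - s) ^ 3\<bar> = p * (p + 1) * z powr (- p - 2) / 6 * \<bar>t - s\<bar> ^ 3"
    using p by (simp add: diff_def abs_mult power_abs fact_numeral)
  also have "\<dots> \<le> p * (p + 1) * a powr (- p - 2) / 6 * \<bar>t - s\<bar> ^ 3"
    using p a \<open>z \<ge> a\<close> by (intro mult_right_mono divide_right_mono mult_left_mono powr_mono2') auto
  finally have "diff 3 z / fact 3 * (t - s) ^ 3 \<ge> - (p * (p + 1) * a powr (- p - 2) / 6 * \<bar>t - s\<bar> ^ 3)"
    by linarith
  moreover have "(\<Sum>k<3. diff k s / fact k * (t - s) ^ k)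
      = \<Phi> s + (1 - s powr (- p)) * (t - s) + p * s powr (- p - 1) / 2 * (t - s)\<^sup>2"
    by (simp add: diff_def lessThan_nat_numeral numeral_2_eq_2)
  ultimately show ?thesis using z(2) by linarith
qed simp

text \<open>Below \<open>a\<close> the profile is continued by its tangent line: the pole at the origin is
  replaced by a constant density, and convexity is preserved.\<close>

definition capped :: "real \<Rightarrow> real \<Rightarrow> real" where
  "capped a s = \<Phi> (max s a) + (1 - a powr (- p)) * min (s - a) 0"

lemma capped_eq: "s \<ge> a \<Longrightarrow> capped a s = \<Phi> s"
  by (simp add: capped_def)

text \<open>The increments of \<open>max\<close> and \<open>min\<close> in the two summands of
  \<open>capped\<close> add up to t - s, and each summand satisfies the inequality with slope c: the
  slope b of the linear piece is at most c, and equals c when s lies below a.\<close>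

lemma capped_tangent_le:
  assumes a: "a > 0"
  shows "capped a t - capped a s \<ge> (1 - (max s a) powr (- p)) * (t - s)"
proof -
  define b c where "b = 1 - a powr (- p)" and "c = 1 - (max s a) powr (- p)"
  have bc: "b \<le> c" using a p by (auto simp: b_def c_def intro!: powr_mono2')
  have "\<Phi> (max t a) - \<Phi> (max s a) \<ge> c * (max t a - max s a)"
    unfolding c_def using a by (intro tangent_le) auto
  moreover have "b * min (t - a) 0 - b * min (s - a) 0 \<ge> c * min (t - a) 0 - c * min (s - a) 0"
  proof (cases "s \<ge> a")
    case True
    then show ?thesis using bc by (simp add: min_def mult_right_mono_neg)
  next
    case False
    then have "b = c" by (simp add: b_def c_def)
    then show ?thesis by simp
  qed
  moreover have "(max t a - max s a) + (min (t - a) 0 - min (s - a) 0) = t - s" by auto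
  then have "c * (t - s) = c * (max t a - max s a) + (c * min (t - a) 0 - c * min (s - a) 0)"
    by (metis distrib_left right_diff_distrib)
  ultimately show ?thesis unfolding capped_def b_def c_def by linarith
qed

end

section \<open>The discrete Laplacian of the radial comparison function\<close>

locale lattice_profile = radial_profile \<Phi> "real CARD('d) / 2" for \<Phi> :: "real \<Rightarrow> real" and D :: "('d :: finite) itself"
begin

text \<open>The factor R^2 undoes the scaling of |x|^2, so that the Laplacian is of order
  one.\<close>

definition profile :: "real \<Rightarrow> real \<Rightarrow> int ^ 'd \<Rightarrow> real" where
  "profile a R x = R\<^sup>2 * capped a ((norm (lat x) / R)\<^sup>2)"

lemma norm_sq_scaled_step:
  assumes "v \<in> unit_vectors" "R > 0"
  shows "(norm (lat (x + v)) / R)\<^sup>2 - (norm (lat x) / R)\<^sup>2 = (2 * (lat x \<bullet> lat v) + 1) / R\<^sup>2"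
  using norm_lat_sq_step[OF assms(1), of x] by (simp add: power_divide diff_divide_distrib[symmetric])

text \<open>The tangent inequality summed over the neighbours, whose increments of |x|^2 have sum
  2d. It rests on convexity alone, so it holds across the edge of the cap as well.\<close>

lemma laplacian_profile_ge:
  fixes x :: "int ^ 'd"
  assumes a: "a > 0" and R: "R > 0"
  shows "laplacian (profile a R) x \<ge> 2 * real CARD('d) * (1 - a powr (- (real CARD('d) / 2)))"
proof -
  define s where "s = (norm (lat x) / R)\<^sup>2"
  define c where "c = 1 - (max s a) powr (- (real CARD('d) / 2))"
  have "2 * real CARD('d) * (1 - a powr (- (real CARD('d) / 2))) \<le> 2 * real CARD('d) * c"
    unfolding c_def using a by (intro mult_left_mono diff_left_mono powr_mono2') auto
  also have "\<dots> = (\<Sum>v\<in>unit_vectors. c * (2 * (lat x \<bullet> lat v) + 1))"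
    unfolding sum_distrib_left[symmetric] sum_step_1 by (simp add: mult.commute)
  also have "\<dots> \<le> laplacian (profile a R) x"
    unfolding laplacian_def
  proof (rule sum_mono)
    fix v :: "int ^ 'd" assume v: "v \<in> unit_vectors"
    have "R\<^sup>2 * (c * ((norm (lat (x + v)) / R)\<^sup>2 - s))
        \<le> R\<^sup>2 * (capped a ((norm (lat (x + v)) / R)\<^sup>2) - capped a s)"
      unfolding c_def by (intro mult_left_mono capped_tangent_le a) auto
    then show "c * (2 * (lat x \<bullet> lat v) + 1) \<le> profile a R (x + v) - profile a R x"
      unfolding s_def norm_sq_scaled_step[OF v R] profile_def right_diff_distrib[symmetric]
      using R by simp
  qed
  finally show ?thesis .
qed

text \<open>The first two moments of the increments reproduce the continuum value 2d, and the
  third-order remainder is O(1 / R). The margin 1 keeps all neighbours of x outside the cap.\<close>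

lemma laplacian_profile_far_ge:
  fixes x :: "int ^ 'd"
  assumes \<eta>: "\<eta> > 0" and R: "R \<ge> 1" and x: "\<eta> * R + 1 \<le> norm (lat x)" "norm (lat x) \<le> R"
  defines "p \<equiv> real CARD('d) / 2"
  shows "laplacian (profile (\<eta>\<^sup>2) R) x
    \<ge> 2 * real CARD('d) - 9 * real CARD('d) * (p * (p + 1) * (\<eta>\<^sup>2) powr (- p - 2)) / R"
proof -
  define s where "s = (norm (lat x) / R)\<^sup>2"
  define K where "K = p * (p + 1) * (\<eta>\<^sup>2) powr (- p - 2) / 6"
  define g where "g v = 2 * (lat x \<bullet> lat v) + 1" for v
  have K: "K \<ge> 0" by (simp add: K_def p_def)
  have ge: "(\<eta>)\<^sup>2 \<le> (norm (lat y) / R)\<^sup>2" if "\<eta> * R \<le> norm (lat y)" for y :: "int ^ 'd"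
    using that \<eta> R by (intro power_mono) (auto simp: field_simps)
  have s: "\<eta>\<^sup>2 \<le> s" unfolding s_def using x by (intro ge) auto
  have s0: "s > 0" using s \<eta> by (meson less_le_trans zero_less_power)
  define c1 c2 where "c1 = 1 - s powr (- p)" and "c2 = p * s powr (- p - 1) / 2"
  have step: "profile (\<eta>\<^sup>2) R (x + v) - profile (\<eta>\<^sup>2) R x \<ge> c1 * g v + c2 / R\<^sup>2 * (g v)\<^sup>2 - 27 * K / R"
    if v: "v \<in> unit_vectors" for v
  proof -
    define t where "t = (norm (lat (x + v)) / R)\<^sup>2"
    have t: "\<eta>\<^sup>2 \<le> t" unfolding t_def using x norm_lat_step_ge[OF v, of x] by (intro ge) auto
    have ts: "t - s = g v / R\<^sup>2"
      unfolding t_def s_def g_def using R by (intro norm_sq_scaled_step[OF v]) auto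
    have "\<bar>lat x \<bullet> lat v\<bar> \<le> norm (lat x) * norm (lat v)" by (rule Cauchy_Schwarz_ineq2)
    \<comment> \<open>2 |x| + 1 \<le> 3 R because |x| \<le> R and R \<ge> 1.\<close>
    then have g: "\<bar>g v\<bar> \<le> 3 * R" using x(2) R norm_lat_unit[OF v] by (simp add: g_def)
    have "\<bar>g v\<bar> ^ 3 \<le> (3 * R) ^ 3" using g by (intro power_mono) auto
    then have cube: "R\<^sup>2 * (K * \<bar>t - s\<bar> ^ 3) \<le> R\<^sup>2 * (K * ((3 * R) ^ 3 / (R\<^sup>2) ^ 3))"
      unfolding ts using K R by (intro mult_left_mono) (auto simp: power_divide abs_divide intro!: divide_right_mono)
    have "R\<^sup>2 * (\<Phi> t - \<Phi> s) \<ge> R\<^sup>2 * (c1 * (t - s) + c2 * (t - s)\<^sup>2 - K * \<bar>t - s\<bar> ^ 3)"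
      unfolding c1_def c2_def K_def p_def
      using \<eta> s t by (intro mult_left_mono second_order_le) auto
    also have "R\<^sup>2 * (c1 * (t - s) + c2 * (t - s)\<^sup>2 - K * \<bar>t - s\<bar> ^ 3)
        = c1 * (R\<^sup>2 * (t - s)) + c2 * (R\<^sup>2 * (t - s)\<^sup>2) - R\<^sup>2 * (K * \<bar>t - s\<bar> ^ 3)"
      by (simp add: algebra_simps)
    also have "R\<^sup>2 * (t - s) = g v" using R by (simp add: ts)
    also have "R\<^sup>2 * (t - s)\<^sup>2 = (g v)\<^sup>2 / R\<^sup>2" using R by (simp add: ts power2_eq_square)
    finally have "R\<^sup>2 * (\<Phi> t - \<Phi> s) \<ge> c1 * g v + c2 * ((g v)\<^sup>2 / R\<^sup>2) - R\<^sup>2 * (K * ((3 * R) ^ 3 / (R\<^sup>2) ^ 3))"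
      using cube by linarith
    also have "R\<^sup>2 * (K * ((3 * R) ^ 3 / (R\<^sup>2) ^ 3)) = 27 * K / R"
      using R by (simp add: power2_eq_square power3_eq_cube)
    finally show ?thesis
      unfolding profile_def t_def[symmetric] s_def[symmetric] capped_eq[OF s] capped_eq[OF t]
        right_diff_distrib[symmetric] by simp
  qed
  have g1: "(\<Sum>v\<in>(unit_vectors :: (int ^ 'd) set). g v) = 2 * real CARD('d)"
    and g2: "(\<Sum>v\<in>(unit_vectors :: (int ^ 'd) set). (g v)\<^sup>2) = 8 * (norm (lat x))\<^sup>2 + 2 * real CARD('d)"
    unfolding g_def by (rule sum_step_1 sum_step_2)+
  have "laplacian (profile (\<eta>\<^sup>2) R) x
      \<ge> (\<Sum>v\<in>(unit_vectors :: (int ^ 'd) set). c1 * g v + c2 / R\<^sup>2 * (g v)\<^sup>2 - 27 * K / R)"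
    unfolding laplacian_def by (intro sum_mono step)
  also have "(\<Sum>v\<in>(unit_vectors :: (int ^ 'd) set). c1 * g v + c2 / R\<^sup>2 * (g v)\<^sup>2 - 27 * K / R)
      = c1 * (2 * real CARD('d)) + c2 / R\<^sup>2 * (8 * (norm (lat x))\<^sup>2 + 2 * real CARD('d)) - 2 * real CARD('d) * (27 * K / R)"
    unfolding sum_subtractf sum.distrib sum_distrib_left[symmetric] g1 g2
    by (simp add: card_unit_vectors)
  also have "\<dots> \<ge> c1 * (2 * real CARD('d)) + 8 * (c2 * s) - 2 * real CARD('d) * (27 * K / R)"
  proof -
    have "c2 / R\<^sup>2 * (8 * (norm (lat x))\<^sup>2) \<le> c2 / R\<^sup>2 * (8 * (norm (lat x))\<^sup>2 + 2 * real CARD('d))"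
      by (intro mult_left_mono) (auto simp: c2_def p_def)
    moreover have "c2 / R\<^sup>2 * (8 * (norm (lat x))\<^sup>2) = 8 * (c2 * s)" by (simp add: s_def power_divide)
    ultimately show ?thesis by linarith
  qed
  \<comment> \<open>So \<open>8 * (c2 * s)\<close> is 2d times \<open>s powr (- p)\<close> and
    cancels the singular part of \<open>c1 * (2 * real CARD('d))\<close>; this is where p = d / 2
    matters.\<close>
  also have "c2 * s = real CARD('d) / 4 * s powr (- p)"
  proof -
    have "s powr (- p - 1) * s = s powr (- p - 1) * s powr 1" using s0 by simp
    also have "\<dots> = s powr (- p)" unfolding powr_add[symmetric] by simp
    finally show ?thesis by (simp add: c2_def p_def)
  qed
  also have "c1 * (2 * real CARD('d)) + 8 * (real CARD('d) / 4 * s powr (- p)) - 2 * real CARD('d) * (27 * K / R)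
      = 2 * real CARD('d) - 9 * real CARD('d) * (p * (p + 1) * (\<eta>\<^sup>2) powr (- p - 2)) / R"
  proof -
    have eq: "2 * real CARD('d) * (27 * K / R)
        = 9 * real CARD('d) * (p * (p + 1) * (\<eta>\<^sup>2) powr (- p - 2)) / R"
      unfolding K_def by simp
    show ?thesis unfolding eq c1_def by (simp add: left_diff_distrib)
  qed
  finally show ?thesis .
qed

end

section \<open>The estimate of the untoppled sites\<close>

context rotor_router begin

text \<open>The terms on the right are, in order, the Taylor error of the profile, the oscillation
  of \<psi> near the origin, the rotor error, and the surplus \<kappa> of the capped charge over n.
  At fixed \<eta> the first and third are of order R^(d - 1), while the second is proportional to
  \<eta> to leading order.\<close>

lemma untoppled_estimate:
  fixes t :: "int ^ 'd \<Rightarrow> nat" and \<Phi> :: "real \<Rightarrow> real" and \<delta> \<epsilon> \<eta> R \<kappa> d C :: real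
  defines "d \<equiv> real CARD('d)"
  defines "C \<equiv> 9 * d * (d / 2 * (d / 2 + 1) * (\<eta>\<^sup>2) powr (- (d / 2) - 2))"
  assumes "radial_profile \<Phi> (d / 2)"
    and stable: "\<And>x. height t x \<le> 0"
    and R: "R \<ge> 1" and \<eta>: "0 < \<eta>" "\<eta> \<le> \<delta>" and \<delta>: "\<delta> < 1" "d * (\<eta> * R + 1) + 1 \<le> \<delta> * R / 2" and \<epsilon>: "0 < \<epsilon>" "\<epsilon> < 1"
    and \<kappa>: "- real_of_int h * ((\<eta>\<^sup>2) powr (- (d / 2)) * card (lattice_ball (\<eta> * R + 1) :: (int ^ 'd) set)) \<le> n + \<kappa>" "\<kappa> \<ge> 0"
    and A: "\<And>x. x \<in> A \<Longrightarrow> t x = 0 \<and> \<delta> * R \<le> norm (lat x) \<and> norm (lat x) \<le> (1 - \<epsilon>) * R"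
  shows "- real_of_int h * card A * (\<Phi> ((1 - \<epsilon>)\<^sup>2) - \<Phi> ((1 + 1 / R)\<^sup>2))
    \<le> - real_of_int h * (2 * C * card (lattice_ball R :: (int ^ 'd) set) / R)
      + (n + \<kappa>) * (8 * d\<^sup>2 * (d + 2) * (\<eta> * R + 1) / (\<delta> * R))
      + 2 * d * (d + 2) * card (lattice_ball (R + 1) :: (int ^ 'd) set) / R + 4 * d * \<kappa>"
proof -
  interpret lattice_profile \<Phi> "TYPE('d)" using assms(3) by (simp add: lattice_profile_def d_def)
  define B S :: "(int ^ 'd) set" where "B = lattice_ball R" and "S = lattice_ball (R + 1)"
  define \<Gamma> :: "int ^ 'd \<Rightarrow> real" where "\<Gamma> = profile (\<eta>\<^sup>2) R"
  have d: "d \<ge> 1" using zero_less_card_finite[where 'a='d] by (simp add: d_def)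
  have \<delta>R: "\<delta> * R / 2 > 1" using \<delta>(2) d \<eta> R mult_pos_pos[of d "\<eta> * R + 1"]
    by (smt (verit) mult_nonneg_nonneg)
  have fin: "finite B" "finite S" "B \<subseteq> S"
    by (simp_all add: B_def S_def lattice_ball_mono)
  have nbr: "x + v \<in> S" if "x \<in> B" "v \<in> unit_vectors" for x v
    using that lattice_ball_step by (simp add: B_def S_def)
  have AB: "A \<subseteq> B"
  proof
    fix x assume "x \<in> A"
    then have "norm (lat x) \<le> (1 - \<epsilon>) * R" using A by blast
    also have "\<dots> < 1 * R" using \<epsilon> R by (intro mult_strict_right_mono) auto
    finally show "x \<in> B" by (simp add: B_def lattice_ball_def)
  qed
  have finA: "finite A" using AB fin(1) by (rule finite_subset)
  obtain \<psi> :: "int ^ 'd \<Rightarrow> real" where lap: "\<And>x. x \<in> B \<Longrightarrow> laplacian \<psi> x = - indicator A x"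
    and out: "\<And>x. x \<notin> B \<Longrightarrow> \<psi> x = 0"
    and \<psi>0: "\<And>x. 0 \<le> \<psi> x" and \<psi>_le: "\<And>x. \<psi> x \<le> 2 * R\<^sup>2"
    using green_potential_exists[OF R, of A] unfolding B_def by blast
  have lap_out: "laplacian \<psi> x \<ge> 0" if "x \<notin> B" for x
    unfolding laplacian_def using \<psi>0 out[OF that] by (intro sum_nonneg) simp
  define \<Psi> where "\<Psi> = (\<Sum>x\<in>B. \<psi> x)"
  have \<Psi>: "0 \<le> \<Psi>" "\<Psi> \<le> card B * (2 * R\<^sup>2)"
    unfolding \<Psi>_def using \<psi>0 \<psi>_le sum_bounded_above[of B \<psi>] by (auto intro: sum_nonneg)
  define E where "E = (\<Sum>x\<in>S. \<Sum>v\<in>unit_vectors. \<bar>\<psi> (x + v) - \<psi> x\<bar>)"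
  have E: "E \<le> (d + 2) * R * card S"
  proof -
    have "(\<Sum>x\<in>S. \<Sum>v\<in>unit_vectors. (\<psi> (x + v) - \<psi> x)\<^sup>2) = - 2 * (\<Sum>x\<in>B. \<psi> x * laplacian \<psi> x)"
      by (rule sum_gradient_sq) (use fin out nbr in auto)
    also have "(\<Sum>x\<in>B. \<psi> x * laplacian \<psi> x) = (\<Sum>x\<in>B. - (if x \<in> A then \<psi> x else 0))"
      by (intro sum.cong) (auto simp: lap)
    also have "- 2 * \<dots> = 2 * (\<Sum>x\<in>A. \<psi> x)"
      using AB fin(1) by (simp add: sum_negf sum.inter_restrict[symmetric] Int_absorb1)
    also have "(\<Sum>x\<in>A. \<psi> x) \<le> (\<Sum>x\<in>S. \<psi> x)"
      using AB fin \<psi>0 by (intro sum_mono2) auto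
    also have "(\<Sum>x\<in>S. \<psi> x) \<le> card S * (2 * R\<^sup>2)"
      using \<psi>_le sum_bounded_above[of S \<psi>] by simp
    finally have en: "(\<Sum>x\<in>S. \<Sum>v\<in>unit_vectors. (\<psi> (x + v) - \<psi> x)\<^sup>2) \<le> 4 * R\<^sup>2 * card S" by (simp add: ac_simps)
    \<comment> \<open>AM-GM with weight R: the energy is at most 4 R^2 per site, so with this weight
      both terms become O(R) per site.\<close>
    have amgm: "\<bar>a\<bar> \<le> a\<^sup>2 / (2 * R) + R / 2" for a :: real
    proof -
      have "0 \<le> (\<bar>a\<bar> - R)\<^sup>2" by simp
      then have "2 * R * \<bar>a\<bar> \<le> a\<^sup>2 + R\<^sup>2" by (simp add: power2_eq_square algebra_simps abs_mult[symmetric])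
      then show ?thesis using R by (simp add: field_simps power2_eq_square)
    qed
    have "E \<le> (\<Sum>x\<in>S. \<Sum>v\<in>unit_vectors. (\<psi> (x + v) - \<psi> x)\<^sup>2 / (2 * R) + R / 2)"
      unfolding E_def by (intro sum_mono amgm)
    also have "\<dots> = (\<Sum>x\<in>S. \<Sum>v\<in>unit_vectors. (\<psi> (x + v) - \<psi> x)\<^sup>2) / (2 * R) + d * R * card S"
      by (simp add: sum.distrib sum_divide_distrib card_unit_vectors d_def)
    also have "\<dots> \<le> (4 * R\<^sup>2 * card S) / (2 * R) + d * R * card S"
      using en R by (intro add_right_mono divide_right_mono) auto
    also have "\<dots> = (d + 2) * R * card S" using R by (simp add: power2_eq_square algebra_simps)
    finally show ?thesis .
  qed
  have B0: "0 \<in> B" using R by (simp add: B_def lattice_ball_def)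
  have test: "(real n - real_of_int h) * \<psi> 0 \<le> - real_of_int h * \<Psi> + E"
    unfolding \<Psi>_def E_def
  proof (rule test_inequality[OF fin(1,2) out fin(3) nbr B0 \<psi>0 stable])
    fix x assume "t x > 0"
    \<comment> \<open>So \<psi> is harmonic at x if x lies in \<open>B\<close>; outside
      \<open>B\<close> it vanishes while its neighbours are nonnegative.\<close>
    then have "x \<notin> A" using A by auto
    then show "laplacian \<psi> x \<ge> 0" using lap[of x] lap_out[of x] by (cases "x \<in> B") auto
  qed
  \<comment> \<open>r is the radius of the core containing the cap and b = \<eta>^(-d) the density
    of the capped charge. \<open>g\<close> bounds the excess of \<psi> over \<psi> 0 on the core: d
    r steps, each with the gradient estimate for M = 2 R^2 and \<rho> = \<delta> R / 2.\<close>
  define r where "r = \<eta> * R + 1"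
  define b where "b = (\<eta>\<^sup>2) powr (- (d / 2))"
  define K where "K = real (card (lattice_ball r :: (int ^ 'd) set))"
  define g where "g = d * r * (2 * R\<^sup>2 * (d + 2) / (\<delta> * R / 2))"
  have g0: "g \<ge> 0" unfolding g_def r_def using d \<eta> R \<delta>R by (intro mult_nonneg_nonneg divide_nonneg_nonneg) auto
  \<comment> \<open>\<open>A\<close> keeps distance \<delta> R from the origin, so \<psi> is
    harmonic in the ball of that radius.\<close>
  have near: "\<psi> x \<le> \<psi> 0 + g" if "x \<in> lattice_ball r" for x
    unfolding g_def d_def
  proof (rule harmonic_near_origin_le[where \<rho>' = "\<delta> * R" and M = "2 * R\<^sup>2"])
    show "laplacian \<psi> y = 0" if "norm (lat y) < \<delta> * R" for y
    proof -
      have "\<delta> * R \<le> 1 * R" using \<delta> R by (intro mult_right_mono) auto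
      then have "y \<in> B" using that by (simp add: B_def lattice_ball_def)
      moreover have "y \<notin> A" using A[of y] that by auto
      ultimately show ?thesis using lap[of y] by simp
    qed
    show "norm (lat x) < r" using that by (simp add: lattice_ball_def)
    show "real CARD('d) * r + \<delta> * R / 2 + 1 \<le> \<delta> * R" using \<delta>(2) by (simp add: r_def d_def)
  qed (use \<delta>R R \<psi>0 \<psi>_le in auto)
  have lower: "(2 * d - C / R) * \<Psi> - 2 * d * b * (K * (\<psi> 0 + g)) \<le> (\<Sum>x\<in>B. \<psi> x * laplacian \<Gamma> x)"
  proof -
    have CR: "C / R \<ge> 0" using d R by (auto simp: C_def intro!: divide_nonneg_nonneg mult_nonneg_nonneg)
    \<comment> \<open>On the core only the convexity bound is available; the rest of
      \<open>B\<close> has the Taylor bound.\<close>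
    have pt: "(2 * d - C / R) - (if x \<in> lattice_ball r then 2 * d * b else 0) \<le> laplacian \<Gamma> x" if "x \<in> B" for x
    proof (cases "x \<in> lattice_ball r")
      case True
      have "2 * d * (1 - b) \<le> laplacian \<Gamma> x"
        unfolding \<Gamma>_def b_def d_def using \<eta> R by (intro laplacian_profile_ge) auto
      then show ?thesis using True CR by (simp add: algebra_simps)
    next
      case False
      have "2 * d - C / R \<le> laplacian \<Gamma> x"
        unfolding \<Gamma>_def C_def d_def
        using laplacian_profile_far_ge[OF \<eta>(1) R, of x] False that by (simp add: B_def lattice_ball_def r_def)
      then show ?thesis using False by simp
    qed
    have "(\<Sum>x\<in>B. if x \<in> lattice_ball r then \<psi> x else 0) \<le> (\<Sum>x\<in>lattice_ball r. \<psi> x)"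
      unfolding sum.inter_restrict[OF fin(1), symmetric] using \<psi>0 by (intro sum_mono2) auto
    also have "\<dots> \<le> K * (\<psi> 0 + g)"
      unfolding K_def using near by (intro sum_bounded_above) auto
    finally have "2 * d * b * (\<Sum>x\<in>B. if x \<in> lattice_ball r then \<psi> x else 0) \<le> 2 * d * b * (K * (\<psi> 0 + g))"
      using d by (intro mult_left_mono) (auto simp: b_def)
    moreover have "(\<Sum>x\<in>B. \<psi> x * ((2 * d - C / R) - (if x \<in> lattice_ball r then 2 * d * b else 0)))
        = (2 * d - C / R) * \<Psi> - 2 * d * b * (\<Sum>x\<in>B. if x \<in> lattice_ball r then \<psi> x else 0)"
      unfolding \<Psi>_def sum_distrib_left sum_subtractf[symmetric]
      by (intro sum.cong) (auto simp: algebra_simps)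
    moreover have "(\<Sum>x\<in>B. \<psi> x * ((2 * d - C / R) - (if x \<in> lattice_ball r then 2 * d * b else 0)))
        \<le> (\<Sum>x\<in>B. \<psi> x * laplacian \<Gamma> x)"
      by (intro sum_mono mult_left_mono pt \<psi>0)
    ultimately show ?thesis by linarith
  qed
  define c \<tau> where "c = \<Phi> ((1 - \<epsilon>)\<^sup>2)" and "\<tau> = \<Phi> ((1 + 1 / R)\<^sup>2)"
  \<comment> \<open>Green's identity moves the Laplacian to \<psi>. The charge -1 sits on the sites
    of \<open>A\<close>, where \<Gamma> is at least R^2 c; the compensating charge sits on the outer
    layer, where \<Gamma> is at most R^2 \<tau>.\<close>
  have upper: "(\<Sum>x\<in>B. \<psi> x * laplacian \<Gamma> x) \<le> - (card A * (R\<^sup>2 * c)) + card A * (R\<^sup>2 * \<tau>)"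
  proof -
    have "(\<Sum>x\<in>B. \<psi> x * laplacian \<Gamma> x) = (\<Sum>x\<in>S. \<Gamma> x * laplacian \<psi> x)"
      by (rule summation_by_parts) (use fin out nbr in auto)
    also have "\<dots> = (\<Sum>x\<in>S - B. \<Gamma> x * laplacian \<psi> x) + (\<Sum>x\<in>B. \<Gamma> x * laplacian \<psi> x)"
      using fin by (intro sum.subset_diff) auto
    also have "(\<Sum>x\<in>B. \<Gamma> x * laplacian \<psi> x) = (\<Sum>x\<in>B. - (if x \<in> A then \<Gamma> x else 0))"
      by (intro sum.cong) (auto simp: lap)
    also have "\<dots> = - (\<Sum>x\<in>A. \<Gamma> x)"
      using AB fin(1) by (simp add: sum_negf sum.inter_restrict[symmetric] Int_absorb1)
    also have "\<dots> \<le> - (card A * (R\<^sup>2 * c))"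
    proof -
      have "R\<^sup>2 * c \<le> \<Gamma> x" if "x \<in> A" for x
      proof -
        define s where "s = norm (lat x) / R"
        have s: "\<delta> \<le> s" "s \<le> 1 - \<epsilon>" using A[OF that] R by (auto simp: s_def field_simps)
        have sq: "\<eta>\<^sup>2 \<le> s\<^sup>2" "s\<^sup>2 \<le> (1 - \<epsilon>)\<^sup>2" "(1 - \<epsilon>)\<^sup>2 \<le> 1" "0 < s\<^sup>2"
          using s \<eta> \<epsilon> by (auto intro!: power_mono power_le_one)
        have "R\<^sup>2 * c \<le> R\<^sup>2 * \<Phi> (s\<^sup>2)"
          unfolding c_def using sq by (intro mult_left_mono antimono) auto
        then show ?thesis unfolding \<Gamma>_def profile_def s_def[symmetric] by (simp only: capped_eq[OF sq(1)])
      qed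
      then have "card A * (R\<^sup>2 * c) \<le> (\<Sum>x\<in>A. \<Gamma> x)" by (intro sum_bounded_below) auto
      then show ?thesis by simp
    qed
    also have "(\<Sum>x\<in>S - B. \<Gamma> x * laplacian \<psi> x) \<le> (\<Sum>x\<in>S - B. (R\<^sup>2 * \<tau>) * laplacian \<psi> x)"
    proof (intro sum_mono mult_right_mono lap_out)
      fix x assume x: "x \<in> S - B"
      define s where "s = norm (lat x) / R"
      have s: "1 \<le> s" "s \<le> 1 + 1 / R" using x R by (auto simp: s_def S_def B_def lattice_ball_def field_simps)
      have "\<eta>\<^sup>2 \<le> 1" using \<eta> \<delta> by (intro power_le_one) auto
      moreover have sq: "1 \<le> s\<^sup>2" "s\<^sup>2 \<le> (1 + 1 / R)\<^sup>2" using s R by (auto intro!: power_mono one_le_power)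
      ultimately have le: "\<eta>\<^sup>2 \<le> s\<^sup>2" by linarith
      have "R\<^sup>2 * \<Phi> (s\<^sup>2) \<le> R\<^sup>2 * \<tau>"
        unfolding \<tau>_def using sq by (intro mult_left_mono nonneg_mono) auto
      then show "\<Gamma> x \<le> R\<^sup>2 * \<tau>"
        unfolding \<Gamma>_def profile_def s_def[symmetric] by (simp only: capped_eq[OF le])
    qed auto
    also have "(\<Sum>x\<in>S - B. (R\<^sup>2 * \<tau>) * laplacian \<psi> x) = (R\<^sup>2 * \<tau>) * (\<Sum>x\<in>S - B. laplacian \<psi> x)"
      by (simp add: sum_distrib_left)
    \<comment> \<open>The total charge is zero, so the outer layer receives what \<open>A\<close>
      emits.\<close>
    also have "(\<Sum>x\<in>S - B. laplacian \<psi> x) = card A"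
    proof -
      have "(\<Sum>x\<in>S. laplacian \<psi> x) = 0"
        by (rule sum_laplacian_eq_0[OF fin(1,2)]) (use fin out nbr in auto)
      moreover have "(\<Sum>x\<in>S. laplacian \<psi> x) = (\<Sum>x\<in>S - B. laplacian \<psi> x) + (\<Sum>x\<in>B. laplacian \<psi> x)"
        using fin by (intro sum.subset_diff) auto
      moreover have "(\<Sum>x\<in>B. laplacian \<psi> x) = - card A"
      proof -
        have "(\<Sum>x\<in>B. laplacian \<psi> x) = (\<Sum>x\<in>B. - (if x \<in> A then 1 else 0))"
          by (intro sum.cong) (auto simp: lap)
        then show ?thesis
          using AB fin(1) by (simp add: sum_negf sum.inter_restrict[symmetric] Int_absorb1)
      qed
      ultimately show ?thesis by linarith
    qed
    finally show ?thesis by (simp add: mult.commute add.commute)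
  qed
  define H where "H = - real_of_int h"
  have H: "H \<ge> 1" using h by (simp add: H_def)
  have K0: "K \<ge> 0" "b \<ge> 0" by (simp_all add: K_def b_def)
  have m0: "0 \<le> \<psi> 0" "\<psi> 0 \<le> 2 * R\<^sup>2" using \<psi>0 \<psi>_le by auto
  have \<kappa>': "H * (b * K) \<le> n + \<kappa>" using \<kappa>(1) by (simp add: H_def b_def K_def r_def)
  have nonneg: "0 \<le> C / R" "0 \<le> H" "0 \<le> d" "0 \<le> (d + 2) * R"
    using H d R by (auto simp: C_def intro!: divide_nonneg_nonneg mult_nonneg_nonneg)
  \<comment> \<open>Up to the common factor 2d: after multiplication by H the core costs at most (n
    + \<kappa>) (\<psi> 0 + g), while the test inequality gives H \<Psi> \<ge> n \<psi> 0 - E. The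
    terms n \<psi> 0 cancel and only errors remain.\<close>
  have "card A * R\<^sup>2 * (c - \<tau>) \<le> C / R * \<Psi> + 2 * d * b * (K * (\<psi> 0 + g)) - 2 * d * \<Psi>"
    using lower upper by (simp add: algebra_simps)
  then have "H * (card A * R\<^sup>2 * (c - \<tau>)) \<le> H * (C / R * \<Psi> + 2 * d * b * (K * (\<psi> 0 + g)) - 2 * d * \<Psi>)"
    using H by (intro mult_left_mono) auto
  also have "\<dots> = H * (C / R * \<Psi>) + 2 * d * ((H * (b * K)) * (\<psi> 0 + g)) - 2 * d * (H * \<Psi>)"
    by (simp add: algebra_simps)
  also have "\<dots> \<le> H * (C / R * (card B * (2 * R\<^sup>2))) + 2 * d * ((n + \<kappa>) * (\<psi> 0 + g)) - 2 * d * (n * \<psi> 0 - (d + 2) * R * card S)"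
  proof (intro diff_mono add_mono mult_left_mono mult_right_mono)
    have "n * \<psi> 0 \<le> (n + H) * \<psi> 0" using m0 H by (intro mult_right_mono) auto
    then show "n * \<psi> 0 - (d + 2) * R * card S \<le> H * \<Psi>" using test E by (simp add: H_def)
  qed (use \<kappa>' \<Psi> g0 m0 nonneg in auto)
  also have "\<dots> = H * (C / R * (card B * (2 * R\<^sup>2))) + 2 * d * (\<kappa> * \<psi> 0) + 2 * d * ((n + \<kappa>) * g) + 2 * d * ((d + 2) * R * card S)"
    by (simp add: algebra_simps)
  also have "\<dots> \<le> H * (C / R * (card B * (2 * R\<^sup>2))) + 2 * d * (\<kappa> * (2 * R\<^sup>2)) + 2 * d * ((n + \<kappa>) * g) + 2 * d * ((d + 2) * R * card S)"
    using m0 \<kappa> nonneg by (intro add_mono mult_left_mono) auto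
  also have "\<dots> = (H * (2 * C * card B / R) + (n + \<kappa>) * (8 * d\<^sup>2 * (d + 2) * (\<eta> * R + 1) / (\<delta> * R))
      + 2 * d * (d + 2) * card S / R + 4 * d * \<kappa>) * R\<^sup>2"
  proof -
    have "\<delta> \<noteq> 0" using \<eta> by auto
    define q where "q = (\<eta> * R + 1) / (\<delta> * R)"
    have "g = 4 * d * (d + 2) * q * R\<^sup>2"
      using R \<open>\<delta> \<noteq> 0\<close> by (simp add: g_def r_def q_def field_simps)
    then have "2 * d * ((n + \<kappa>) * g) = (n + \<kappa>) * (8 * d\<^sup>2 * (d + 2) * q) * R\<^sup>2"
      by (simp add: power2_eq_square)
    then have "2 * d * ((n + \<kappa>) * g) = (n + \<kappa>) * (8 * d\<^sup>2 * (d + 2) * (\<eta> * R + 1) / (\<delta> * R)) * R\<^sup>2"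
      by (simp add: q_def)
    moreover have "2 * d * ((d + 2) * R * card S) = 2 * d * (d + 2) * card S / R * R\<^sup>2"
      using R by (simp add: power2_eq_square)
    ultimately show ?thesis by (simp add: distrib_right algebra_simps)
  qed
  finally have "(H * card A * (c - \<tau>)) * R\<^sup>2 \<le> \<dots>" by (simp add: algebra_simps)
  then show ?thesis
    unfolding H_def c_def \<tau>_def B_def S_def using R by (simp only: mult_le_cancel_right) simp
qed

lemma final_untoppled_estimate:
  fixes \<Phi> :: "real \<Rightarrow> real" and \<delta> \<epsilon> \<eta> R \<kappa> d C :: real
  defines "d \<equiv> real CARD('d)"
  defines "C \<equiv> 9 * d * (d / 2 * (d / 2 + 1) * (\<eta>\<^sup>2) powr (- (d / 2) - 2))"
  assumes "radial_profile \<Phi> (d / 2)" "R \<ge> 1" "0 < \<eta>" "\<eta> \<le> \<delta>" "\<delta> < 1"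
    "d * (\<eta> * R + 1) + 1 \<le> \<delta> * R / 2" "0 < \<epsilon>" "\<epsilon> < 1"
    "- real_of_int h * ((\<eta>\<^sup>2) powr (- (d / 2)) * card (lattice_ball (\<eta> * R + 1) :: (int ^ 'd) set)) \<le> n + \<kappa>" "\<kappa> \<ge> 0"
  defines "A \<equiv> {x. \<not> topplings (final_configuration e h D0 n) x > 0 \<and>
    \<delta> * R \<le> norm (lat x) \<and> norm (lat x) \<le> (1 - \<epsilon>) * R}"
  shows "- real_of_int h * card A * (\<Phi> ((1 - \<epsilon>)\<^sup>2) - \<Phi> ((1 + 1 / R)\<^sup>2))
    \<le> - real_of_int h * (2 * C * card (lattice_ball R :: (int ^ 'd) set) / R)
      + (n + \<kappa>) * (8 * d\<^sup>2 * (d + 2) * (\<eta> * R + 1) / (\<delta> * R))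
      + 2 * d * (d + 2) * card (lattice_ball (R + 1) :: (int ^ 'd) set) / R + 4 * d * \<kappa>"
proof -
  obtain t where "final_configuration e h D0 n = state t" "\<And>x. height t x \<le> 0"
    using final_configuration_exists by metis
  then show ?thesis
    unfolding d_def C_def A_def
    using assms(3-12) by (intro untoppled_estimate[where t = t]) (auto simp: d_def)
qed

lemma final_mass_bound:
  defines "T \<equiv> {x. topplings (final_configuration e h D0 n) x > 0}"
    and "P \<equiv> {x. particles (final_configuration e h D0 n) x > h}"
  shows "finite (T \<union> P)" "- h * int (card T) + int (card (T \<union> P - T)) \<le> int n - h"
proof -
  obtain t where t: "final_configuration e h D0 n = state t" "\<And>x. t x > 0 \<Longrightarrow> height t x = 0"
    "finite {x. t x > 0}"
    using final_configuration_exists by metis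
  show "finite (T \<union> P)" "- h * int (card T) + int (card (T \<union> P - T)) \<le> int n - h"
    using mass_bound[OF t(3,2)] by (simp_all add: T_def P_def t(1))
qed

end

section \<open>Volume and lattice point counts\<close>

lemma mem_cell_iff: "y \<in> cell x \<longleftrightarrow> (\<forall>i. \<bar>y $ i - real_of_int (x $ i)\<bar> \<le> 1 / 2)"
proof -
  have half: "- 1 / 2 \<le> z \<and> z \<le> 1 / 2 \<longleftrightarrow> \<bar>z\<bar> \<le> 1 / 2" for z :: real
    by (auto simp: abs_if)
  have "y \<in> cell x \<longleftrightarrow> y - lat x \<in> cbox (\<chi> i. - 1/2) (\<chi> i. 1/2)"
    unfolding cell_def lat_def[symmetric] image_iff
    by (metis add.commute add_diff_cancel diff_add_cancel)
  then show ?thesis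
    by (simp only: mem_box_cart vec_lambda_beta half vector_minus_component lat_nth)
qed

text \<open>A crude bound through the l1 norm; any constant is harmless at scale R.\<close>

lemma dist_cell:
  assumes "y \<in> cell (x :: int ^ 'd)"
  shows "norm (y - lat x) < real CARD('d)"
proof -
  have "norm (y - lat x) \<le> (\<Sum>i\<in>UNIV. \<bar>(y - lat x) $ i\<bar>)" by (rule norm_le_l1_cart)
  also have "\<dots> \<le> (\<Sum>i\<in>(UNIV :: 'd set). 1 / 2)"
    using assms by (intro sum_mono) (simp add: mem_cell_iff)
  also have "\<dots> < real CARD('d)" using zero_less_card_finite[where 'a='d] by simp
  finally show ?thesis .
qed

lemma ex_cell: "\<exists>x. y \<in> cell x"
proof
  show "y \<in> cell (\<chi> i. round (y $ i))"
    unfolding mem_cell_iff vec_lambda_beta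
    by (subst abs_minus_commute) (blast intro: of_int_round_abs_le)
qed

lemma cell_eq_cbox: "cell x = cbox (lat x - (\<chi> i. 1/2)) (lat x + (\<chi> i. 1/2))"
proof -
  have abs_c: "a - c \<le> z \<and> z \<le> a + c \<longleftrightarrow> \<bar>z - a\<bar> \<le> c" for a c z :: real
    by (auto simp: abs_if)
  show ?thesis
    unfolding set_eq_iff mem_cell_iff mem_box_cart vector_add_component vector_minus_component
      vec_lambda_beta lat_nth abs_c by simp
qed

lemma emeasure_unit_box:
  fixes x :: "int ^ 'd"
  shows "emeasure lebesgue (box (lat x - (\<chi> i. 1/2)) (lat x + (\<chi> i. 1/2))) = 1"
proof -
  have b: "((\<chi> i. 1/2) :: real ^ 'd) \<bullet> b = 1 / 2" if "b \<in> Basis" for b :: "real ^ 'd"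
    using that by (auto simp: Basis_vec_def inner_axis)
  have "emeasure lborel (box (lat x - (\<chi> i. 1/2)) (lat x + (\<chi> i. 1/2)))
      = (\<Prod>b\<in>Basis. ((lat x + (\<chi> i. 1/2)) - (lat x - (\<chi> i. 1/2))) \<bullet> b)"
    by (rule emeasure_lborel_box) (simp add: inner_add_left inner_diff_left b)
  also have "\<dots> = ennreal (\<Prod>b\<in>(Basis :: (real ^ 'd) set). 1)"
    by (rule arg_cong[of _ _ ennreal], rule prod.cong[OF refl]) (auto simp: Basis_vec_def inner_axis)
  finally show ?thesis by simp
qed

lemma emeasure_cell: "emeasure lebesgue (cell x) = 1"
proof -
  have "emeasure lebesgue (cell x) = emeasure lebesgue (box (lat x - (\<chi> i. 1/2)) (lat x + (\<chi> i. 1/2)))"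
    unfolding cell_eq_cbox by (simp add: emeasure_lborel_cbox_eq emeasure_lborel_box_eq)
  then show ?thesis by (simp only: emeasure_unit_box)
qed

lemma sets_cell [simp]: "cell x \<in> sets lebesgue"
  by (simp add: cell_eq_cbox)

lemma emeasure_cells_le: "finite W \<Longrightarrow> emeasure lebesgue (\<Union>x\<in>W. cell x) \<le> of_nat (card W)"
  using emeasure_subadditive_finite[of W cell lebesgue] by (simp add: emeasure_cell image_subset_iff)

text \<open>Cells share faces, so their disjoint open interiors are counted instead.\<close>

lemma emeasure_cells_ge:
  fixes W :: "(int ^ 'd) set"
  assumes "finite W"
  shows "of_nat (card W) \<le> emeasure lebesgue (\<Union>x\<in>W. cell x)"
proof -
  define b where "b x = box (lat x - (\<chi> i. 1/2)) (lat x + (\<chi> i. 1/2))" for x :: "int ^ 'd"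
  have bs: "b x \<in> sets lebesgue" for x by (simp add: b_def)
  have "disjoint_family_on b W"
    unfolding disjoint_family_on_def
  proof (intro ballI impI)
    fix x y :: "int ^ 'd" assume "x \<noteq> y"
    then obtain i where i: "x $ i \<noteq> y $ i" by (auto simp: vec_eq_iff)
    show "b x \<inter> b y = {}"
    proof (rule ccontr)
      assume "b x \<inter> b y \<noteq> {}"
      then obtain z where "z \<in> b x" "z \<in> b y" by blast
      then have "\<bar>real_of_int (x $ i) - z $ i\<bar> < 1/2" "\<bar>real_of_int (y $ i) - z $ i\<bar> < 1/2"
        unfolding b_def mem_box_cart by (auto simp: abs_if dest!: spec[of _ i])
      then have "\<bar>x $ i - y $ i\<bar> < 1" by linarith
      then show False using i by linarith
    qed
  qed
  then have "emeasure lebesgue (\<Union>x\<in>W. b x) = (\<Sum>x\<in>W. emeasure lebesgue (b x))"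
    using assms bs by (intro sum_emeasure[symmetric]) auto
  also have "\<dots> = of_nat (card W)" by (simp add: b_def emeasure_unit_box)
  finally have "of_nat (card W) = emeasure lebesgue (\<Union>x\<in>W. b x)" by (rule sym)
  also have "\<dots> \<le> emeasure lebesgue (\<Union>x\<in>W. cell x)"
  proof (rule emeasure_mono)
    have "b x \<subseteq> cell x" for x unfolding b_def cell_eq_cbox by (rule box_subset_cbox)
    then show "(\<Union>x\<in>W. b x) \<subseteq> (\<Union>x\<in>W. cell x)" by blast
  qed (use assms in auto)
  finally show ?thesis .
qed

lemma emeasure_lebesgue_ball:
  fixes \<rho> :: real
  assumes "\<rho> \<ge> 0"
  shows "emeasure lebesgue (ball (0 :: real ^ 'd) \<rho>) = ennreal (unit_ball_vol CARD('d) * \<rho> ^ CARD('d))"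
  using emeasure_ball[OF assms, of "0 :: real ^ 'd"] by simp

text \<open>The cells of the counted points lie in a ball of radius enlarged by d; compare
  volumes.\<close>

lemma card_lattice_ball_le:
  fixes \<rho> :: real
  assumes "\<rho> \<ge> 0"
  shows "card (lattice_ball \<rho> :: (int ^ 'd) set) \<le> unit_ball_vol CARD('d) * (\<rho> + CARD('d)) ^ CARD('d)"
proof -
  have sub: "(\<Union>x\<in>lattice_ball \<rho>. cell x) \<subseteq> ball (0 :: real ^ 'd) (\<rho> + CARD('d))"
  proof clarify
    fix x :: "int ^ 'd" and y assume "x \<in> lattice_ball \<rho>" "y \<in> cell x"
    then show "y \<in> ball 0 (\<rho> + CARD('d))"
      using dist_cell[of y x] norm_triangle_sub[of y "lat x"] by (simp add: lattice_ball_def)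
  qed
  have "ennreal (card (lattice_ball \<rho> :: (int ^ 'd) set)) \<le> emeasure lebesgue (\<Union>x\<in>(lattice_ball \<rho> :: (int ^ 'd) set). cell x)"
    using emeasure_cells_ge[OF finite_lattice_ball] by (simp add: ennreal_of_nat_eq_real_of_nat)
  also have "\<dots> \<le> emeasure lebesgue (ball (0 :: real ^ 'd) (\<rho> + CARD('d)))"
    using sub by (intro emeasure_mono) auto
  also have "\<dots> = ennreal (unit_ball_vol CARD('d) * (\<rho> + CARD('d)) ^ CARD('d))"
    using assms by (intro emeasure_lebesgue_ball) auto
  finally show ?thesis using assms by (subst (asm) ennreal_le_iff) auto
qed

text \<open>Conversely, the cells of the counted points cover the ball of radius reduced by
  d.\<close>

lemma card_lattice_ball_ge:
  fixes \<rho> :: real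
  assumes "\<rho> \<ge> CARD('d)"
  shows "card (lattice_ball \<rho> :: (int ^ 'd) set) \<ge> unit_ball_vol CARD('d) * (\<rho> - CARD('d)) ^ CARD('d)"
proof -
  have sub: "ball (0 :: real ^ 'd) (\<rho> - CARD('d)) \<subseteq> (\<Union>x\<in>lattice_ball \<rho>. cell x)"
  proof
    fix y :: "real ^ 'd" assume y: "y \<in> ball 0 (\<rho> - CARD('d))"
    obtain x where x: "y \<in> cell x" using ex_cell by blast
    then have "x \<in> lattice_ball \<rho>"
      using dist_cell[of y x] norm_triangle_sub[of "lat x" y] y by (simp add: lattice_ball_def norm_minus_commute)
    then show "y \<in> (\<Union>x\<in>lattice_ball \<rho>. cell x)" using x by blast
  qed
  have "ennreal (unit_ball_vol CARD('d) * (\<rho> - CARD('d)) ^ CARD('d)) = emeasure lebesgue (ball (0 :: real ^ 'd) (\<rho> - CARD('d)))"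
    using assms by (intro emeasure_lebesgue_ball[symmetric]) auto
  also have "\<dots> \<le> emeasure lebesgue (\<Union>x\<in>(lattice_ball \<rho> :: (int ^ 'd) set). cell x)"
    using sub by (intro emeasure_mono) auto
  also have "\<dots> \<le> ennreal (card (lattice_ball \<rho> :: (int ^ 'd) set))"
    using emeasure_cells_le[OF finite_lattice_ball] by (simp add: ennreal_of_nat_eq_real_of_nat)
  finally show ?thesis by (subst (asm) ennreal_le_iff) auto
qed

section \<open>Asymptotic density of lattice points in growing balls\<close>

lemma affine_over_tendsto:
  assumes "filterlim R at_top F"
  shows "((\<lambda>n. (a * R n + c) / R n :: real) \<longlongrightarrow> a) F"
proof -
  have "((\<lambda>n. a + c / R n) \<longlongrightarrow> a + 0) F"
    by (intro tendsto_intros tendsto_divide_0[OF tendsto_const] filterlim_at_top_imp_at_infinity assms)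
  moreover have "\<forall>\<^sub>F n in F. R n > 0" using assms by (simp add: filterlim_at_top_dense)
  then have "\<forall>\<^sub>F n in F. a + c / R n = (a * R n + c) / R n"
    by eventually_elim (simp add: add_divide_distrib)
  ultimately show ?thesis by (simp add: Lim_transform_eventually)
qed

lemma affine_power_over_tendsto:
  assumes "filterlim R at_top F"
  shows "((\<lambda>n. (a * R n + c) ^ k / R n ^ k :: real) \<longlongrightarrow> a ^ k) F"
  unfolding power_divide[symmetric] by (intro tendsto_power affine_over_tendsto assms)

lemma card_lattice_ball_tendsto:
  assumes R: "filterlim R at_top F" and a: "a > 0"
  shows "((\<lambda>n. card (lattice_ball (a * R n + c) :: (int ^ 'd) set) / R n ^ CARD('d))
    \<longlongrightarrow> unit_ball_vol CARD('d) * a ^ CARD('d)) F"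
proof (rule tendsto_sandwich)
  define \<omega> where "\<omega> = unit_ball_vol (real CARD('d))"
  have ev: "\<forall>\<^sub>F n in F. a * R n + c \<ge> CARD('d)" "\<forall>\<^sub>F n in F. R n > 0"
  proof -
    have "filterlim (\<lambda>n. a * R n + c) at_top F"
      using filterlim_tendsto_add_at_top[OF tendsto_const[of c]
          filterlim_tendsto_pos_mult_at_top[OF tendsto_const a R]] by (simp add: add.commute)
    then show "\<forall>\<^sub>F n in F. a * R n + c \<ge> CARD('d)" by (simp add: filterlim_at_top)
    show "\<forall>\<^sub>F n in F. R n > 0" using R by (simp add: filterlim_at_top_dense)
  qed
  show "\<forall>\<^sub>F n in F. \<omega> * ((a * R n + (c - CARD('d))) ^ CARD('d) / R n ^ CARD('d))
      \<le> card (lattice_ball (a * R n + c) :: (int ^ 'd) set) / R n ^ CARD('d)"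
    using ev
  proof eventually_elim
    case (elim n)
    have "\<omega> * (a * R n + (c - CARD('d))) ^ CARD('d) \<le> card (lattice_ball (a * R n + c) :: (int ^ 'd) set)"
      using card_lattice_ball_ge[OF elim(1)] by (simp add: \<omega>_def add_diff_eq)
    from divide_right_mono[OF this, of "R n ^ CARD('d)"] show ?case using elim by simp
  qed
  show "\<forall>\<^sub>F n in F. card (lattice_ball (a * R n + c) :: (int ^ 'd) set) / R n ^ CARD('d)
      \<le> \<omega> * ((a * R n + (c + CARD('d))) ^ CARD('d) / R n ^ CARD('d))"
    using ev
  proof eventually_elim
    case (elim n)
    have "card (lattice_ball (a * R n + c) :: (int ^ 'd) set) \<le> \<omega> * (a * R n + (c + CARD('d))) ^ CARD('d)"
      using card_lattice_ball_le[of "a * R n + c"] elim by (simp add: \<omega>_def add.assoc)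
    from divide_right_mono[OF this, of "R n ^ CARD('d)"] show ?case using elim by simp
  qed
qed (intro tendsto_intros affine_power_over_tendsto R)+

section \<open>The limit\<close>

text \<open>Divided by R^d, the estimate has a limit proportional to \<eta>, so \<eta> is chosen
  after \<delta>, \<epsilon> and \<zeta>.\<close>

lemma untoppled_annulus_negligible:
  fixes e :: "nat \<Rightarrow> int ^ 'd" and R :: "nat \<Rightarrow> real"
  defines "d \<equiv> real CARD('d)"
  defines "\<omega> \<equiv> unit_ball_vol d"
  assumes rr: "rotor_router e h D0"
    and R: "filterlim R at_top sequentially"
    and n: "\<And>n. real n = - real_of_int h * (\<omega> * R n ^ CARD('d))"
    and \<delta>: "0 < \<delta>" "\<delta> < 1" and \<epsilon>: "0 < \<epsilon>" "\<epsilon> < 1" and \<zeta>: "\<zeta> > 0"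
  shows "\<forall>\<^sub>F n in sequentially. card {x. \<not> topplings (final_configuration e h D0 n) x > 0 \<and>
    \<delta> * R n \<le> norm (lat x) \<and> norm (lat x) \<le> (1 - \<epsilon>) * R n} / R n ^ CARD('d) \<le> \<zeta>"
proof -
  define k where "k = CARD('d)"
  have dk: "d = real k" by (simp add: d_def k_def)
  have d: "d \<ge> 1" using zero_less_card_finite[where 'a='d] by (simp add: d_def)
  have \<omega>: "\<omega> > 0" using d by (simp add: \<omega>_def)
  define H where "H = - real_of_int h"
  have H: "H \<ge> 1" using rr by (simp add: rotor_router_def H_def)
  obtain \<Phi> where \<Phi>: "\<Phi> 1 = (0 :: real)"
    "\<And>s. s > 0 \<Longrightarrow> (\<Phi> has_real_derivative 1 - s powr (- (d / 2))) (at s)"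
    using radial_profile_exists[of "d / 2"] by metis
  have rp: "radial_profile \<Phi> (d / 2)" using \<Phi> d by (simp add: radial_profile_def)
  define c where "c = \<Phi> ((1 - \<epsilon>)\<^sup>2)"
  have c: "c > 0" unfolding c_def
    using \<epsilon> by (intro radial_profile.pos[OF rp]) (simp_all add: abs_square_less_1)
  define G where "G = 8 * d\<^sup>2 * (d + 2) * \<omega> / (\<delta> * c)"
  have G: "G > 0" using d \<omega> \<delta> c by (simp add: G_def)
  \<comment> \<open>The first bound gives
    \<open>d * (\<eta> * R + 1) + 1 \<le> \<delta> * R / 2\<close> once R is large; the second makes
    the limit \<open>G * \<eta>\<close> at most \<zeta> / 2.\<close>
  define \<eta> where "\<eta> = min (\<delta> / (4 * d)) (\<zeta> / (2 * G))"
  have \<eta>: "0 < \<eta>" "\<eta> \<le> \<delta>" "d * \<eta> \<le> \<delta> / 4" "G * \<eta> < \<zeta>"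
  proof -
    show "0 < \<eta>" using d \<delta> \<zeta> G by (simp add: \<eta>_def)
    have 1: "\<eta> \<le> \<delta> / (4 * d)" by (simp add: \<eta>_def)
    then show 2: "d * \<eta> \<le> \<delta> / 4" using d by (simp add: field_simps)
    have "1 * \<eta> \<le> d * \<eta>" using d \<open>0 < \<eta>\<close> by (intro mult_right_mono) auto
    with 2 \<delta> show "\<eta> \<le> \<delta>" by simp
    have "\<eta> \<le> \<zeta> / (2 * G)" by (simp add: \<eta>_def)
    then have "G * \<eta> \<le> \<zeta> / 2" using G by (simp add: field_simps)
    then show "G * \<eta> < \<zeta>" using \<zeta> by simp
  qed
  define b where "b = (\<eta>\<^sup>2) powr (- (d / 2))"
  \<comment> \<open>The capped charge, density b on a ball of radius \<eta> R, has the volume of the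
    ball of radius R. Hence H times it is n to leading order.\<close>
  have b: "b * \<eta> ^ k = 1"
  proof -
    have "\<eta>\<^sup>2 = \<eta> powr 2" using \<eta>(1) by simp
    then have "b = \<eta> powr (- d)" unfolding b_def by (simp only: powr_powr) simp
    then show ?thesis using \<eta>(1) by (simp add: dk powr_minus powr_realpow)
  qed
  define C where "C = 9 * d * (d / 2 * (d / 2 + 1) * (\<eta>\<^sup>2) powr (- (d / 2) - 2))"
  define N where "N \<rho> = real (card (lattice_ball \<rho> :: (int ^ 'd) set))" for \<rho>
  \<comment> \<open>The surplus caused by counting lattice points, truncated at 0; it is
    o(R^d).\<close>
  define \<kappa> where "\<kappa> n = max 0 (H * (b * N (\<eta> * R n + 1)) - n)" for n :: nat
  define \<tau> where "\<tau> n = \<Phi> ((1 + 1 / R n)\<^sup>2)" for n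
  define a where "a n = real (card {x. \<not> topplings (final_configuration e h D0 n) x > 0 \<and>
    \<delta> * R n \<le> norm (lat x) \<and> norm (lat x) \<le> (1 - \<epsilon>) * R n})" for n
  define P where "P n = H * (2 * C * (N (R n) / R n ^ k) / R n)
      + (n / R n ^ k + \<kappa> n / R n ^ k) * (8 * d\<^sup>2 * (d + 2) * ((\<eta> * R n + 1) / R n) / \<delta>)
      + 2 * d * (d + 2) * (N (R n + 1) / R n ^ k) / R n + 4 * d * (\<kappa> n / R n ^ k)" for n :: nat
  define Q where "Q n = P n / (H * (c - \<tau> n))" for n
  have Rpos: "\<forall>\<^sub>F n in sequentially. R n > M" for M using R by (simp add: filterlim_at_top_dense)
  have Rinf: "filterlim R at_infinity sequentially" by (rule filterlim_at_top_imp_at_infinity[OF R])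
  have Nlim: "(\<lambda>n. N (a * R n + c) / R n ^ k) \<longlonglongrightarrow> \<omega> * a ^ k" if "a > 0" for a c
    unfolding N_def k_def \<omega>_def d_def using R that by (rule card_lattice_ball_tendsto)
  have nlim: "(\<lambda>n. n / R n ^ k) \<longlonglongrightarrow> H * \<omega>"
  proof (rule tendsto_eventually)
    show "\<forall>\<^sub>F n in sequentially. n / R n ^ k = H * \<omega>"
      using Rpos[of 0] by eventually_elim (simp add: n H_def k_def)
  qed
  have \<kappa>lim: "(\<lambda>n. \<kappa> n / R n ^ k) \<longlonglongrightarrow> 0"
  proof (rule Lim_transform_eventually)
    have "(\<lambda>n. max 0 (H * (b * (N (\<eta> * R n + 1) / R n ^ k)) - n / R n ^ k)) \<longlonglongrightarrow> max 0 (H * (b * (\<omega> * \<eta> ^ k)) - H * \<omega>)"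
      by (intro tendsto_intros nlim Nlim \<eta>)
    moreover have "H * (b * (\<omega> * \<eta> ^ k)) = H * \<omega>" using b by simp
    ultimately show "(\<lambda>n. max 0 (H * (b * (N (\<eta> * R n + 1) / R n ^ k)) - n / R n ^ k)) \<longlonglongrightarrow> 0" by simp
    show "\<forall>\<^sub>F n in sequentially. max 0 (H * (b * (N (\<eta> * R n + 1) / R n ^ k)) - n / R n ^ k) = \<kappa> n / R n ^ k"
      using Rpos[of 0] by eventually_elim (auto simp: \<kappa>_def max_def field_simps)
  qed
  have \<tau>lim: "\<tau> \<longlonglongrightarrow> 0"
  proof -
    have "isCont \<Phi> 1" using \<Phi>(2)[of 1] by (intro DERIV_isCont) auto
    moreover have "(\<lambda>n. (1 + 1 / R n)\<^sup>2) \<longlonglongrightarrow> (1 + 0)\<^sup>2"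
      by (intro tendsto_intros tendsto_divide_0[OF tendsto_const Rinf])
    ultimately have "(\<lambda>n. \<Phi> ((1 + 1 / R n)\<^sup>2)) \<longlonglongrightarrow> \<Phi> 1"
      by (intro isCont_tendsto_compose[of 1 \<Phi>]) auto
    then show ?thesis by (simp add: \<tau>_def[abs_def] \<Phi>)
  qed
  \<comment> \<open>Only the oscillation term survives in the limit.\<close>
  have "Q \<longlonglongrightarrow> (0 + (H * \<omega> + 0) * (8 * d\<^sup>2 * (d + 2) * \<eta> / \<delta>) + 0 + 4 * d * 0) / (H * (c - 0))"
    unfolding Q_def P_def
  proof (intro tendsto_intros nlim \<kappa>lim \<tau>lim)
    show "(\<lambda>n. (\<eta> * R n + 1) / R n) \<longlonglongrightarrow> \<eta>" by (rule affine_over_tendsto[OF R])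
    show "(\<lambda>n. 2 * d * (d + 2) * (N (R n + 1) / R n ^ k) / R n) \<longlonglongrightarrow> 0"
      using tendsto_divide_0[OF tendsto_mult[OF tendsto_const Nlim[of 1 1]] Rinf] by simp
    have "(\<lambda>n. H * (2 * C * (N (R n) / R n ^ k) / R n)) \<longlonglongrightarrow> H * 0"
      using tendsto_divide_0[OF tendsto_mult[OF tendsto_const Nlim[of 1 0]] Rinf]
      by (intro tendsto_mult[OF tendsto_const]) simp
    then show "(\<lambda>n. H * (2 * C * (N (R n) / R n ^ k) / R n)) \<longlonglongrightarrow> 0" by simp
  qed (use H c \<delta> in auto)
  also have "(0 + (H * \<omega> + 0) * (8 * d\<^sup>2 * (d + 2) * \<eta> / \<delta>) + 0 + 4 * d * 0) / (H * (c - 0)) = G * \<eta>"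
    using H c \<delta> by (simp add: G_def field_simps)
  finally have "\<forall>\<^sub>F n in sequentially. Q n < \<zeta>" using \<eta>(4) by (rule order_tendstoD)
  moreover have "\<forall>\<^sub>F n in sequentially. \<tau> n < c" using \<tau>lim c by (rule order_tendstoD)
  ultimately have "\<forall>\<^sub>F n in sequentially. a n / R n ^ k \<le> \<zeta>"
    using Rpos[of 1] Rpos[of "4 * (d + 1) / \<delta>"]
  proof eventually_elim
    case (elim n)
    note Rn = elim(3)
    have \<tau>: "H * (c - \<tau> n) > 0" using elim(2) H by simp
    have "4 * (d + 1) \<le> \<delta> * R n" using elim(4) \<delta> by (simp add: field_simps)
    moreover have "(d * \<eta>) * R n \<le> \<delta> / 4 * R n" using \<eta>(3) Rn by (intro mult_right_mono) auto
    ultimately have cond: "d * (\<eta> * R n + 1) + 1 \<le> \<delta> * R n / 2"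
      by (simp add: algebra_simps)
    have "H * (b * N (\<eta> * R n + 1)) \<le> n + \<kappa> n" by (simp add: \<kappa>_def)
    then have "H * a n * (c - \<tau> n) \<le> H * (2 * C * N (R n) / R n)
        + (n + \<kappa> n) * (8 * d\<^sup>2 * (d + 2) * (\<eta> * R n + 1) / (\<delta> * R n))
        + 2 * d * (d + 2) * N (R n + 1) / R n + 4 * d * \<kappa> n"
      unfolding H_def a_def c_def \<tau>_def N_def C_def b_def d_def
      using rp Rn \<eta>(1,2) \<delta> \<epsilon> cond
      by (intro rotor_router.final_untoppled_estimate[OF rr]) (auto simp: d_def \<kappa>_def)
    also have "\<dots> = P n * R n ^ k"
    proof -
      have "H * (2 * C * N (R n) / R n) = H * (2 * C * (N (R n) / R n ^ k) / R n) * R n ^ k"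
        "(n + \<kappa> n) * (8 * d\<^sup>2 * (d + 2) * (\<eta> * R n + 1) / (\<delta> * R n))
          = (n / R n ^ k + \<kappa> n / R n ^ k) * (8 * d\<^sup>2 * (d + 2) * ((\<eta> * R n + 1) / R n) / \<delta>) * R n ^ k"
        "2 * d * (d + 2) * N (R n + 1) / R n = 2 * d * (d + 2) * (N (R n + 1) / R n ^ k) / R n * R n ^ k"
        "4 * d * \<kappa> n = 4 * d * (\<kappa> n / R n ^ k) * R n ^ k"
        using Rn by (simp_all add: add_divide_distrib[symmetric] mult.commute[of \<delta>])
      then show ?thesis by (simp only: P_def distrib_right)
    qed
    also have "P n = Q n * (H * (c - \<tau> n))"
      using less_imp_neq[OF \<tau>] by (intro nonzero_divide_eq_eq[THEN iffD1]) (auto simp: Q_def)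
    finally have "a n * (H * (c - \<tau> n)) \<le> (Q n * R n ^ k) * (H * (c - \<tau> n))" by (simp add: mult_ac)
    then have "a n \<le> Q n * R n ^ k" using \<tau> by (simp only: mult_le_cancel_right)
    then have "a n / R n ^ k \<le> Q n" using Rn by (simp add: field_simps)
    then show ?case using elim(1) by simp
  qed
  then show ?thesis by (simp only: a_def k_def)
qed

text \<open>The annulus misses a core of radius s R and a shell beyond (1 - s) R; their joint
  density tends to 0 with s, and trivially bounds the untoppled sites there.\<close>

lemma untoppled_ball_negligible:
  fixes e :: "nat \<Rightarrow> int ^ 'd" and R :: "nat \<Rightarrow> real"
  defines "\<omega> \<equiv> unit_ball_vol (real CARD('d))"
  assumes rr: "rotor_router e h D0"
    and R: "filterlim R at_top sequentially"
    and n: "\<And>n. real n = - real_of_int h * (\<omega> * R n ^ CARD('d))"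
  shows "(\<lambda>n. card (lattice_ball (R n) - {x. topplings (final_configuration e h D0 n) x > 0}) / R n ^ CARD('d))
    \<longlonglongrightarrow> 0"
proof -
  define k where "k = CARD('d)"
  define N where "N \<rho> = real (card (lattice_ball \<rho> :: (int ^ 'd) set))" for \<rho>
  define T where "T n = {x. topplings (final_configuration e h D0 n) x > 0}" for n
  define u where "u n = card (lattice_ball (R n) - T n) / R n ^ k" for n
  have k: "k > 0" by (simp add: k_def)
  have \<omega>: "\<omega> > 0" by (simp add: \<omega>_def)
  have Rpos: "\<forall>\<^sub>F n in sequentially. R n > 0" using R by (simp add: filterlim_at_top_dense)
  have Nlim: "(\<lambda>n. N (a * R n) / R n ^ k) \<longlonglongrightarrow> \<omega> * a ^ k" if "a > 0" for a
    using card_lattice_ball_tendsto[OF R that, of 0, where 'd='d] by (simp add: N_def k_def \<omega>_def)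
  have bound: "\<forall>\<^sub>F n in sequentially. u n < 2 * \<zeta>" if \<zeta>: "\<zeta> > 0" for \<zeta>
  proof -
    \<comment> \<open>Continuity at s = 0 yields an s in (0, 1) for which core and shell together
      have density below \<zeta>.\<close>
    have "((\<lambda>s. \<omega> * s ^ k + \<omega> * 1 ^ k - \<omega> * (1 - s) ^ k) \<longlongrightarrow> \<omega> * 0 ^ k + \<omega> * 1 ^ k - \<omega> * (1 - 0) ^ k) (at_right 0)"
      by (intro tendsto_intros)
    moreover have "\<omega> * 0 ^ k + \<omega> * 1 ^ k - \<omega> * (1 - 0) ^ k < \<zeta>" using \<zeta> k by (simp add: zero_power)
    ultimately have "\<forall>\<^sub>F s in at_right 0. \<omega> * s ^ k + \<omega> * 1 ^ k - \<omega> * (1 - s) ^ k < \<zeta>"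
      by (rule order_tendstoD)
    moreover have "\<forall>\<^sub>F s in at_right (0 :: real). s \<in> {0<..<1}" by (rule eventually_at_right_real) simp
    ultimately have "\<forall>\<^sub>F s in at_right 0. \<omega> * s ^ k + \<omega> * 1 ^ k - \<omega> * (1 - s) ^ k < \<zeta> \<and> 0 < s \<and> s < 1"
      by eventually_elim auto
    then have "\<exists>s. \<omega> * s ^ k + \<omega> * 1 ^ k - \<omega> * (1 - s) ^ k < \<zeta> \<and> 0 < s \<and> s < 1"
      by (rule eventually_happens'[OF trivial_limit_at_right_real])
    then obtain s where s: "0 < s" "s < 1" "\<omega> * s ^ k + \<omega> * 1 ^ k - \<omega> * (1 - s) ^ k < \<zeta>"
      by blast
    define a where "a n = real (card {x. \<not> topplings (final_configuration e h D0 n) x > 0 \<and>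
      s * R n \<le> norm (lat x) \<and> norm (lat x) \<le> (1 - s) * R n})" for n
    have a: "\<forall>\<^sub>F n in sequentially. a n / R n ^ k \<le> \<zeta>"
      unfolding a_def k_def
      by (rule untoppled_annulus_negligible[OF rr R n[unfolded \<omega>_def] s(1,2) s(1,2) \<zeta>])
    have "(\<lambda>n. N (s * R n) / R n ^ k + N (1 * R n) / R n ^ k - N ((1 - s) * R n) / R n ^ k)
        \<longlonglongrightarrow> \<omega> * s ^ k + \<omega> * 1 ^ k - \<omega> * (1 - s) ^ k"
      using s by (intro tendsto_intros Nlim) auto
    then have "\<forall>\<^sub>F n in sequentially. N (s * R n) / R n ^ k + N (1 * R n) / R n ^ k - N ((1 - s) * R n) / R n ^ k < \<zeta>"
      using s(3) by (rule order_tendstoD)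
    with a Rpos show ?thesis
    proof eventually_elim
      case (elim n)
      define A where "A = {x. \<not> topplings (final_configuration e h D0 n) x > 0 \<and>
        s * R n \<le> norm (lat x) \<and> norm (lat x) \<le> (1 - s) * R n}"
      have sub: "lattice_ball ((1 - s) * R n) \<subseteq> (lattice_ball (R n) :: (int ^ 'd) set)"
        using s elim(2) by (intro lattice_ball_mono) (auto simp: mult_le_cancel_right1)
      have "(1 - s) * R n < R n" using s elim(2) by simp
      then have finA: "finite A"
        by (intro finite_subset[OF _ finite_lattice_ball[of "R n"]]) (auto simp: A_def lattice_ball_def)
      have "card (lattice_ball (R n) - T n)
          \<le> card (A \<union> lattice_ball (s * R n) \<union> (lattice_ball (R n) - lattice_ball ((1 - s) * R n)))"
      proof (rule card_mono)
        show "finite (A \<union> lattice_ball (s * R n) \<union> (lattice_ball (R n) - lattice_ball ((1 - s) * R n)))"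
          using finA by simp
      qed (auto simp: A_def T_def lattice_ball_def)
      also have "\<dots> \<le> card A + card (lattice_ball (s * R n) :: (int ^ 'd) set)
          + card (lattice_ball (R n) - lattice_ball ((1 - s) * R n) :: (int ^ 'd) set)"
        by (meson card_Un_le add_le_mono le_trans order_refl)
      finally have "real (card (lattice_ball (R n) - T n)) \<le> a n + N (s * R n)
          + real (card (lattice_ball (R n) - lattice_ball ((1 - s) * R n) :: (int ^ 'd) set))"
        unfolding a_def A_def[symmetric] N_def by linarith
      also have "real (card (lattice_ball (R n) - lattice_ball ((1 - s) * R n) :: (int ^ 'd) set))
          = N (1 * R n) - N ((1 - s) * R n)"
        unfolding N_def using sub by (simp add: card_Diff_subset card_mono of_nat_diff)
      finally have "u n \<le> (a n + N (s * R n) + (N (1 * R n) - N ((1 - s) * R n))) / R n ^ k"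
        unfolding u_def using elim(2) by (intro divide_right_mono) auto
      also have "\<dots> < 2 * \<zeta>" using elim(1,3) by (simp add: add_divide_distrib diff_divide_distrib)
      finally show ?case .
    qed
  qed
  have "u \<longlonglongrightarrow> 0"
  proof (rule order_tendstoI)
    fix a :: real assume "a < 0"
    then show "\<forall>\<^sub>F n in sequentially. a < u n"
      using Rpos by (auto elim!: eventually_mono simp: u_def intro: less_le_trans)
  next
    fix a :: real assume "0 < a"
    then show "\<forall>\<^sub>F n in sequentially. u n < a" using bound[of "a / 2"] by simp
  qed
  then show ?thesis by (simp only: u_def[abs_def] k_def T_def)
qed

text \<open>Purely a count: if T misses only u sites of the ball, then the mass bound leaves little
  for sites elsewhere. Here H is |h| and N0 stands for n / |h|.\<close>

lemma emeasure_cluster_diff_le: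
  fixes W T :: "(int ^ 'd) set" and \<rho> N0 c u :: real and H :: nat and N :: "real \<Rightarrow> real"
  assumes W: "finite W" "T \<subseteq> W" and mass: "H * card T + card (W - T) \<le> H * N0 + H" and H: "H \<ge> 1"
  defines "N r \<equiv> real (card (lattice_ball r :: (int ^ 'd) set))"
    and "c \<equiv> real CARD('d)" and "u \<equiv> real (card (lattice_ball \<rho> - T))"
  shows "emeasure lebesgue (sym_diff (\<Union>x\<in>W. cell x) (ball 0 \<rho>))
    \<le> ennreal (N (\<rho> + c) - N \<rho> + (N0 - N (\<rho> - c)) + H + (real H - 1) * (N0 - N \<rho>) + (H + 1) * u)"
proof -
  define B B' B'' :: "(int ^ 'd) set"
    where "B = lattice_ball \<rho>" and "B' = lattice_ball (\<rho> - c)" and "B'' = lattice_ball (\<rho> + c)"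
  have fin: "finite B" "finite B'" "finite B''" "finite T"
    using W by (auto simp: B_def B'_def B''_def intro: finite_subset)
  have sub: "B' \<subseteq> B" "B \<subseteq> B''" by (auto simp: B_def B'_def B''_def c_def lattice_ball_def)
  \<comment> \<open>A cell of \<open>W\<close> reaching outside the ball has its centre outside
    \<open>B'\<close>; a cell meeting the ball has its centre in \<open>B''\<close>.\<close>
  define U where "U = (W - B') \<union> (B'' - W)"
  have finU: "finite U" using W fin by (simp add: U_def)
  have "sym_diff (\<Union>x\<in>W. cell x) (ball 0 \<rho>) \<subseteq> (\<Union>x\<in>U. cell x)"
  proof
    fix y assume y: "y \<in> sym_diff (\<Union>x\<in>W. cell x) (ball 0 \<rho>)"
    \<comment> \<open>Faces belong to several cells; a point of the cluster is assigned a cell of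
      \<open>W\<close>.\<close>
    obtain x where x: "y \<in> cell x" "x \<in> W \<or> y \<notin> (\<Union>x\<in>W. cell x)" using ex_cell by blast
    have "norm (y - lat x) < c" unfolding c_def by (rule dist_cell[OF x(1)])
    then have "norm (lat x) < norm y + c" "norm y < norm (lat x) + c"
      using norm_triangle_sub[of y "lat x"] norm_triangle_sub[of "lat x" y]
      by (auto simp: norm_minus_commute)
    then have "x \<in> U" using y x by (auto simp: U_def B'_def B''_def lattice_ball_def)
    then show "y \<in> (\<Union>x\<in>U. cell x)" using x(1) by blast
  qed
  then have "emeasure lebesgue (sym_diff (\<Union>x\<in>W. cell x) (ball 0 \<rho>)) \<le> emeasure lebesgue (\<Union>x\<in>U. cell x)"
    using finU by (intro emeasure_mono) auto
  also have "\<dots> \<le> ennreal (real (card U))"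
    using emeasure_cells_le[OF finU] by (simp add: ennreal_of_nat_eq_real_of_nat)
  also have "\<dots> \<le> ennreal (N (\<rho> + c) - N \<rho> + (N0 - N (\<rho> - c)) + H + (real H - 1) * (N0 - N \<rho>) + (H + 1) * u)"
  proof (rule ennreal_leI)
    have "card U \<le> card (W - B') + card (B'' - W)" unfolding U_def by (rule card_Un_le)
    moreover have "card (B'' - W) \<le> card ((B'' - B) \<union> (B - T))"
      using fin W by (intro card_mono) auto
    moreover have "card ((B'' - B) \<union> (B - T)) \<le> card (B'' - B) + card (B - T)" by (rule card_Un_le)
    moreover have "card (B'' - B) = card B'' - card B" "card B \<le> card B''"
      using sub fin by (auto intro: card_Diff_subset card_mono)
    moreover have "card W = card (W - B') + card (W \<inter> B')"
      using W(1) by (metis card_Diff_subset_Int card_mono finite_Int inf_le1 le_add_diff_inverse2)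
    moreover have "card B' \<le> card ((W \<inter> B') \<union> (B - T))"
      using fin W sub by (intro card_mono) auto
    moreover have "card ((W \<inter> B') \<union> (B - T)) \<le> card (W \<inter> B') + card (B - T)" by (rule card_Un_le)
    moreover have "card W = card T + card (W - T)"
      using W fin by (simp add: card_Diff_subset card_mono)
    ultimately have 1: "real (card U) \<le> real (card T) + real (card (W - T)) - real (card B') + real (card B'') - real (card B) + 2 * u"
      unfolding u_def B_def[symmetric] by linarith
    have "card B \<le> card (T \<union> (B - T))" using fin by (intro card_mono) auto
    also have "\<dots> \<le> card T + card (B - T)" by (rule card_Un_le)
    finally have "real (card B) - u \<le> card T" unfolding u_def B_def[symmetric] by linarith
    \<comment> \<open>Subtracted from the mass bound, this turns weight H per toppled site into
      weight 1 and so bounds \<open>card W\<close>; the case H = 1 loses nothing.\<close>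
    then have "(real H - 1) * (card B - u) \<le> (real H - 1) * card T" using H by (intro mult_left_mono) auto
    then show "real (card U) \<le> N (\<rho> + c) - N \<rho> + (N0 - N (\<rho> - c)) + H + (real H - 1) * (N0 - N \<rho>) + (H + 1) * u"
      using 1 mass unfolding N_def B_def[symmetric] B'_def[symmetric] B''_def[symmetric]
      by (simp add: algebra_simps)
  qed
  finally show ?thesis .
qed

theorem theorem4p3:
  fixes e :: "nat \<Rightarrow> int ^ 'd"
    and h :: int
    and D0 :: "int ^ 'd \<Rightarrow> nat"
    and r :: real
  assumes "unit_vector_enumeration e"
    and "h \<le> -1"
    and "\<forall>x. D0 x < 2 * CARD('d)"
    and "emeasure lebesgue (ball (0 :: real ^ 'd) r) = 1"
  shows "(\<lambda>n. emeasure lebesgue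
            (sym_diff
               ((*\<^sub>R) ((real n / \<bar>real_of_int h\<bar>) powr (- 1 / real CARD('d)))
                  ` particle_cluster e h D0 n)
               (ball (0 :: real ^ 'd) r))) \<longlonglongrightarrow> 0"
proof -
  define k where "k = CARD('d)"
  define c where "c = real k"
  have k: "k \<ge> 1" using zero_less_card_finite[where 'a='d] by (simp add: k_def)
  define \<omega> where "\<omega> = unit_ball_vol (real k)"
  have \<omega>: "\<omega> > 0" by (simp add: \<omega>_def)
  have r: "r > 0" using assms(4) by (cases "r > 0") (simp_all add: ball_empty)
  have \<omega>r: "\<omega> * r ^ k = 1"
  proof -
    have "ennreal (\<omega> * r ^ k) = 1"
      using emeasure_lebesgue_ball[OF less_imp_le[OF r], where 'd='d] assms(4) by (simp only: \<omega>_def k_def)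
    then show ?thesis by simp
  qed
  have rr: "rotor_router e h D0" using assms by (simp add: rotor_router_def)
  define H where "H = nat (- h)"
  have H: "real H = \<bar>real_of_int h\<bar>" "H \<ge> 1" "real H = - real_of_int h" "int H = - h"
    using assms(2) by (auto simp: H_def)
  \<comment> \<open>\<open>R n\<close> is the radius of the ball of volume n / |h|, and for n \<ge>
    1 dilation by \<open>s n\<close> takes it to r.\<close>
  define s where "s n = (real n / H) powr (- 1 / real k)" for n
  define R where "R n = r * (real n / H) powr (1 / real k)" for n
  have s: "s n > 0" "R n = r / s n" if "n \<ge> 1" for n
    using that H(2) by (auto simp: s_def R_def powr_minus field_simps)
  have Rk: "\<omega> * R n ^ k = real n / H" for n
  proof -
    have "((real n / H) powr (1 / real k)) ^ k = real n / H"
      using k H(2) by (cases "n = 0") (simp_all add: powr_power)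
    then show ?thesis using \<omega>r by (simp add: R_def power_mult_distrib mult.assoc[symmetric])
  qed
  have nR: "real n = - real_of_int h * (\<omega> * R n ^ k)" for n
    using H(2) unfolding Rk H(3)[symmetric] by simp
  have Rlim: "filterlim R at_top sequentially"
    unfolding filterlim_at_top_dense
  proof
    fix Z
    have "\<forall>\<^sub>F n in sequentially. H * (\<omega> * \<bar>Z\<bar> ^ k) < real n"
      using filterlim_real_sequentially by (simp add: filterlim_at_top_dense)
    then show "\<forall>\<^sub>F n in sequentially. Z < R n"
    proof eventually_elim
      case (elim n)
      then have "\<omega> * \<bar>Z\<bar> ^ k < \<omega> * R n ^ k" unfolding Rk using H(2) by (simp add: field_simps)
      then have "\<bar>Z\<bar> ^ k < R n ^ k" using \<omega> by simp
      moreover have "0 \<le> R n" using r by (simp add: R_def)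
      ultimately have "\<bar>Z\<bar> < R n" by (rule power_less_imp_less_base)
      then show ?case by simp
    qed
  qed
  define T where "T n = {x. topplings (final_configuration e h D0 n) x > 0}" for n
  define W where "W n = T n \<union> {x. particles (final_configuration e h D0 n) x > h}" for n
  define N where "N \<rho> = real (card (lattice_ball \<rho> :: (int ^ 'd) set))" for \<rho>
  define u where "u n = real (card (lattice_ball (R n) - T n))" for n
  define g where "g n = N (R n + c) - N (R n) + (n / H - N (R n - c)) + H + (real H - 1) * (n / H - N (R n)) + (H + 1) * u n" for n
  have cluster: "particle_cluster e h D0 n = (\<Union>x\<in>W n. cell x)" for n
    by (auto simp: particle_cluster_def toppling_cluster_def W_def T_def)
  have le: "emeasure lebesgue (sym_diff ((*\<^sub>R) (s n) ` particle_cluster e h D0 n) (ball 0 r))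
      \<le> ennreal (r ^ k * (g n / R n ^ k))" if "n \<ge> 1" for n
  proof -
    note s = s[OF that]
    \<comment> \<open>Both sets are images under the dilation by \<open>s n\<close>, so the estimate
      is made at lattice scale and multiplied by \<open>s n ^ k\<close>.\<close>
    have ball: "ball (0 :: real ^ 'd) r = (*\<^sub>R) (s n) ` ball 0 (R n)"
      using s ball_scale[of "s n" "0 :: real ^ 'd" "R n"] by simp
    have "sym_diff ((*\<^sub>R) (s n) ` particle_cluster e h D0 n) (ball 0 r)
        = (*\<^sub>R) (s n) ` sym_diff (\<Union>x\<in>W n. cell x) (ball 0 (R n))"
      unfolding ball cluster using s(1) by (simp add: image_Un image_set_diff inj_on_def)
    then have "emeasure lebesgue (sym_diff ((*\<^sub>R) (s n) ` particle_cluster e h D0 n) (ball 0 r))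
        = ennreal (s n ^ k) * emeasure lebesgue (sym_diff (\<Union>x\<in>W n. cell x) (ball 0 (R n)))"
      using emeasure_lebesgue_affine[of "s n" 0 "sym_diff (\<Union>x\<in>W n. cell x) (ball 0 (R n))"] s(1)
      by (simp add: k_def)
    also have "\<dots> \<le> ennreal (s n ^ k) * ennreal (g n)"
    proof (rule mult_left_mono)
      have "- h * int (card (T n)) + int (card (W n - T n)) \<le> int n - h" and fin: "finite (W n)"
        using rotor_router.final_mass_bound[OF rr, of n] by (simp_all add: T_def W_def)
      then have "real_of_int (- h * int (card (T n)) + int (card (W n - T n))) \<le> real_of_int (int n - h)"
        by (simp only: of_int_le_iff)
      then have "real H * card (T n) + card (W n - T n) \<le> real n + H" unfolding H(3) by simp
      then have "H * card (T n) + card (W n - T n) \<le> H * (real n / H) + H"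
        using H(2) by simp
      then show "emeasure lebesgue (sym_diff (\<Union>x\<in>W n. cell x) (ball 0 (R n))) \<le> ennreal (g n)"
        unfolding g_def N_def c_def k_def u_def
        using fin H(2) by (intro emeasure_cluster_diff_le) (auto simp: W_def)
    qed simp
    also have "\<dots> = ennreal (s n ^ k * g n)" using s(1) by (simp add: ennreal_mult')
    also have "s n ^ k * g n = r ^ k * (g n / R n ^ k)" using s r by (simp add: power_divide)
    finally show ?thesis .
  qed
  have Nlim: "(\<lambda>n. N (R n + a) / R n ^ k) \<longlonglongrightarrow> \<omega>" for a
    using card_lattice_ball_tendsto[OF Rlim, of 1 a, where 'd='d] by (simp add: N_def k_def \<omega>_def)
  have ulim: "(\<lambda>n. u n / R n ^ k) \<longlonglongrightarrow> 0"
    unfolding u_def T_def k_def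
    by (rule untoppled_ball_negligible[OF rr Rlim nR[unfolded \<omega>_def k_def]])
  have Rpos: "\<forall>\<^sub>F n in sequentially. R n > 0" using Rlim by (simp add: filterlim_at_top_dense)
  have Rklim: "(\<lambda>n. real H / R n ^ k) \<longlonglongrightarrow> 0"
    using k by (intro tendsto_divide_0[OF tendsto_const] filterlim_at_top_imp_at_infinity filterlim_pow_at_top Rlim) auto
  have "(\<lambda>n. g n / R n ^ k) \<longlonglongrightarrow> 0"
  proof (rule Lim_transform_eventually)
    \<comment> \<open>Every normalised count tends to \<omega>, which is also n / H divided by
      \<open>R n ^ k\<close>, so the differences cancel. The forms \<open>R n + 0\<close> and
      \<open>R n + (- c)\<close> match \<open>Nlim\<close>.\<close>
    have "(\<lambda>n. N (R n + c) / R n ^ k - N (R n + 0) / R n ^ k + (\<omega> - N (R n + (- c)) / R n ^ k) + real H / R n ^ k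
        + (real H - 1) * (\<omega> - N (R n + 0) / R n ^ k) + (H + 1) * (u n / R n ^ k))
      \<longlonglongrightarrow> \<omega> - \<omega> + (\<omega> - \<omega>) + 0 + (real H - 1) * (\<omega> - \<omega>) + real (H + 1) * 0"
      by (intro tendsto_intros Nlim ulim Rklim)
    then show "(\<lambda>n. N (R n + c) / R n ^ k - N (R n + 0) / R n ^ k + (\<omega> - N (R n + (- c)) / R n ^ k) + real H / R n ^ k
        + (real H - 1) * (\<omega> - N (R n + 0) / R n ^ k) + (H + 1) * (u n / R n ^ k)) \<longlonglongrightarrow> 0" by simp
    show "\<forall>\<^sub>F n in sequentially. N (R n + c) / R n ^ k - N (R n + 0) / R n ^ k + (\<omega> - N (R n + (- c)) / R n ^ k) + real H / R n ^ k
        + (real H - 1) * (\<omega> - N (R n + 0) / R n ^ k) + (H + 1) * (u n / R n ^ k) = g n / R n ^ k"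
      using Rpos
    proof eventually_elim
      case (elim n)
      then have "\<omega> = real n / H / R n ^ k" unfolding Rk[symmetric] by simp
      then show ?case by (simp add: g_def add_divide_distrib diff_divide_distrib right_diff_distrib)
    qed
  qed
  then have "(\<lambda>n. r ^ k * (g n / R n ^ k)) \<longlonglongrightarrow> r ^ k * 0" by (intro tendsto_intros)
  then have "(\<lambda>n. ennreal (r ^ k * (g n / R n ^ k))) \<longlonglongrightarrow> ennreal 0"
    by (intro tendsto_ennrealI) simp
  then have lim: "(\<lambda>n. ennreal (r ^ k * (g n / R n ^ k))) \<longlonglongrightarrow> 0" by simp
  have "(\<lambda>n. emeasure lebesgue (sym_diff ((*\<^sub>R) (s n) ` particle_cluster e h D0 n) (ball 0 r))) \<longlonglongrightarrow> 0"
  proof (rule tendsto_sandwich[OF _ _ tendsto_const lim])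
    show "\<forall>\<^sub>F n in sequentially. emeasure lebesgue (sym_diff ((*\<^sub>R) (s n) ` particle_cluster e h D0 n) (ball 0 r))
        \<le> ennreal (r ^ k * (g n / R n ^ k))"
      using eventually_ge_at_top[of 1] by eventually_elim (rule le)
  qed simp
  then show ?thesis by (simp only: s_def H(1) k_def)
qed

end
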